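(* Assume $\xi\in L^2(\mathcal F_T)$, $L,R$ satisfy Assumption (L,R) with $\mathsf E[L(T,\xi)]\le0\le\mathsf E[R(T,\xi)]$, $f$ satisfies Assumption (f), and let $(Y,Z,K)\in\mathcal S^2\times\mathcal H^2\times BV[0,T]$ be the solution of the BSDE with double mean reflections (P). Define $\bar Y_t=\mathsf E[\xi+\int_t^Tf(s,Y_s,Z_s)ds\mid\mathcal F_t]$, and for each $t\in[0,T]$ let $\bar r_t$ and $\bar l_t$ be the unique real numbers such that $$\mathsf E\big[R(t,\bar Y_t-\mathsf E[\bar Y_t]+\bar r_t)\big]=0,\qquad \mathsf E\big[L(t,\bar Y_t-\mathsf E[\bar Y_t]+\bar l_t)\big]=0.$$ For $t\le s,q\le T$ set $$J_t(s,q)=\mathsf E\Big[\int_t^{s\wedge q}f(u,Y_u,Z_u)\,du+\xi\,\mathbf 1_{\{s\wedge q=T\}}\Big]+\bar r_q\,\mathbf 1_{\{q<T,\ q\le s\}}+\bar l_s\,\mathbf 1_{\{s<q\}}.$$ Then for every $t\in[0,T]$, $$\mathsf E[Y_t]=\sup_{q\in[t,T]}\inf_{s\in[t,T]}J_t(s,q)=\inf_{s\in[t,T]}\sup_{q\in[t,T]}J_t(s,q).$$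
   Context: $(\Omega,\mathcal F,\mathbb F,\mathsf P)$ complete probability space, $B$ standard one-dimensional Brownian motion, $\mathbb F$ its augmented natural filtration, $T>0$. $\mathcal S^2,\mathcal H^2$: the usual spaces of adapted continuous processes with $\mathsf E\sup|Y|^2<\infty$, resp. predictable processes with $\mathsf E\int_0^T|Z|^2<\infty$; $BV[0,T]$: continuous deterministic functions starting at $0$ of bounded variation; $I[0,T]$: continuous nondecreasing deterministic functions starting at $0$. Problem (P): $Y_t=\xi+\int_t^Tf(s,Y_s,Z_s)ds-\int_t^TZ_sdB_s+K_T-K_t$; $\mathsf E[L(t,Y_t)]\le0\le\mathsf E[R(t,Y_t)]$ for all $t$; $K=K^R-K^L$ with $K^R,K^L\in I[0,T]$, $\int_0^T\mathsf E[R(t,Y_t)]dK^R_t=\int_0^T\mathsf E[L(t,Y_t)]dK^L_t=0$. Assumption (L,R): $L,R:\Omega\times[0,T]\times\mathbb{R}\to\mathbb{R}$ are $\mathcal F_T\otimes\mathcal B([0,T])\otimes\mathcal B(\mathbb{R})$-measurable and (1) continuous in $t$ for each $(\omega,x)$; (2) $\mathsf E[\sup_t|L(t,0)|]<\infty$, $\mathsf E[\sup_t|R(t,0)|]<\infty$; (3) strictly increasing in $x$ with $c|x-y|\le|L(\omega,t,x)-L(\omega,t,y)|\le C|x-y|$ and likewise for $R$, for some $0<c<C$; (4) $\inf_{\omega,t,x}(R-L)>0$. Assumption (f): $f:\Omega\times[0,T]\times\mathbb{R}^2\to\mathbb{R}$ progressively measurable for each $(y,z)$, $\lambda$-Lipschitz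 in $(y,z)$ (i.e. $|f(t,y,z)-f(t,y',z')|\le\lambda(|y-y'|+|z-z'|)$), and $\mathsf E\int_0^T|f(t,0,0)|^2dt<\infty$. *)

theory Defs
  imports "HOL-Probability.Probability"
begin

text \<open>Setting: probability space M (complete), standard Brownian motion B,
  its augmented natural filtration F, horizon T.  Random variables are functions
  on the sample space; processes are indexed by time first: Y t omega.\<close>

definition complete_space_measure :: "'a measure \<Rightarrow> bool" where
  "complete_space_measure M \<longleftrightarrow> (\<forall>A N. N \<in> null_sets M \<and> A \<subseteq> N \<longrightarrow> A \<in> sets M)"

definition std_brownian_motion :: "'a measure \<Rightarrow> (real \<Rightarrow> 'a \<Rightarrow> real) \<Rightarrow> bool" where
  "std_brownian_motion M B \<longleftrightarrow>
     (\<forall>t. B t \<in> borel_measurable M) \<and>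
     (\<forall>\<omega>\<in>space M. B 0 \<omega> = 0 \<and> continuous_on {0..} (\<lambda>t. B t \<omega>)) \<and>
     (\<forall>s t. 0 \<le> s \<and> s < t \<longrightarrow>
        distributed M lborel (\<lambda>\<omega>. B t \<omega> - B s \<omega>) (\<lambda>x. ennreal (normal_density 0 (sqrt (t - s)) x))) \<and>
     (\<forall>\<tau>::nat \<Rightarrow> real. strict_mono \<tau> \<and> 0 \<le> \<tau> 0 \<longrightarrow>
        prob_space.indep_vars M (\<lambda>_. borel) (\<lambda>i \<omega>. B (\<tau> (Suc i)) \<omega> - B (\<tau> i) \<omega>) UNIV)"

definition aug_nat_filtration :: "'a measure \<Rightarrow> (real \<Rightarrow> 'a \<Rightarrow> real) \<Rightarrow> real \<Rightarrow> 'a measure" where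
  "aug_nat_filtration M B t = sigma (space M)
     ({B s -` A \<inter> space M | s A. 0 \<le> s \<and> s \<le> t \<and> A \<in> sets borel} \<union> null_sets M)"

definition predictable_sigma :: "'a measure \<Rightarrow> (real \<Rightarrow> 'a measure) \<Rightarrow> real \<Rightarrow> (real \<times> 'a) measure" where
  "predictable_sigma M F T = sigma ({0..T} \<times> space M)
     ({{s<..t} \<times> A | s t A. 0 \<le> s \<and> s \<le> t \<and> t \<le> T \<and> A \<in> sets (F s)} \<union>
      {{0} \<times> A | A. A \<in> sets (F 0)})"

definition in_S2 :: "'a measure \<Rightarrow> (real \<Rightarrow> 'a measure) \<Rightarrow> real \<Rightarrow> (real \<Rightarrow> 'a \<Rightarrow> real) \<Rightarrow> bool" where
  "in_S2 M F T Y \<longleftrightarrow>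
     (\<forall>t\<in>{0..T}. Y t \<in> borel_measurable (F t)) \<and>
     (\<forall>\<omega>\<in>space M. continuous_on {0..T} (\<lambda>t. Y t \<omega>)) \<and>
     integrable M (\<lambda>\<omega>. (SUP t\<in>{0..T}. \<bar>Y t \<omega>\<bar>)\<^sup>2)"

definition in_H2 :: "'a measure \<Rightarrow> (real \<Rightarrow> 'a measure) \<Rightarrow> real \<Rightarrow> (real \<Rightarrow> 'a \<Rightarrow> real) \<Rightarrow> bool" where
  "in_H2 M F T Z \<longleftrightarrow>
     (\<lambda>(t,\<omega>). Z t \<omega>) \<in> borel_measurable (predictable_sigma M F T) \<and>
     (\<integral>\<^sup>+\<omega>. (\<integral>\<^sup>+t\<in>{0..T}. ennreal ((Z t \<omega>)\<^sup>2) \<partial>lborel) \<partial>M) < \<infinity>"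

definition in_I :: "real \<Rightarrow> (real \<Rightarrow> real) \<Rightarrow> bool" where
  "in_I T K \<longleftrightarrow> K 0 = 0 \<and> continuous_on {0..T} K \<and> mono_on {0..T} K"

definition simple_pred :: "'a measure \<Rightarrow> (real \<Rightarrow> 'a measure) \<Rightarrow> real \<Rightarrow> nat \<Rightarrow> (nat \<Rightarrow> real) \<Rightarrow> (nat \<Rightarrow> 'a \<Rightarrow> real) \<Rightarrow> bool" where
  "simple_pred M F T k \<tau> \<zeta> \<longleftrightarrow> 0 \<le> \<tau> 0 \<and> \<tau> k \<le> T \<and> (\<forall>i<k. \<tau> i \<le> \<tau> (Suc i)) \<and>
     (\<forall>i<k. \<zeta> i \<in> borel_measurable (F (\<tau> i)) \<and> (\<exists>C. \<forall>\<omega>\<in>space M. \<bar>\<zeta> i \<omega>\<bar> \<le> C))"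

definition simple_proc :: "nat \<Rightarrow> (nat \<Rightarrow> real) \<Rightarrow> (nat \<Rightarrow> 'a \<Rightarrow> real) \<Rightarrow> real \<Rightarrow> 'a \<Rightarrow> real" where
  "simple_proc k \<tau> \<zeta> t \<omega> = (\<Sum>i<k. \<zeta> i \<omega> * indicator {\<tau> i<..\<tau> (Suc i)} t)"

definition elem_int :: "(real \<Rightarrow> 'a \<Rightarrow> real) \<Rightarrow> nat \<Rightarrow> (nat \<Rightarrow> real) \<Rightarrow> (nat \<Rightarrow> 'a \<Rightarrow> real) \<Rightarrow> real \<Rightarrow> 'a \<Rightarrow> real" where
  "elem_int B k \<tau> \<zeta> t \<omega> = (\<Sum>i<k. \<zeta> i \<omega> * (B (min (\<tau> (Suc i)) t) \<omega> - B (min (\<tau> i) t) \<omega>))"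

definition is_ito_integral :: "'a measure \<Rightarrow> (real \<Rightarrow> 'a measure) \<Rightarrow> (real \<Rightarrow> 'a \<Rightarrow> real) \<Rightarrow> real \<Rightarrow>
    (real \<Rightarrow> 'a \<Rightarrow> real) \<Rightarrow> (real \<Rightarrow> 'a \<Rightarrow> real) \<Rightarrow> bool" where
  "is_ito_integral M F B T Z I \<longleftrightarrow>
     (\<forall>t\<in>{0..T}. I t \<in> borel_measurable M) \<and>
     (\<exists>k \<tau> \<zeta>. (\<forall>n. simple_pred M F T (k n) (\<tau> n) (\<zeta> n)) \<and>
        (\<lambda>n. \<integral>\<^sup>+\<omega>. (\<integral>\<^sup>+t\<in>{0..T}. ennreal ((simple_proc (k n) (\<tau> n) (\<zeta> n) t \<omega> - Z t \<omega>)\<^sup>2) \<partial>lborel) \<partial>M)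
           \<longlonglongrightarrow> 0 \<and>
        (\<forall>t\<in>{0..T}. (\<lambda>n. \<integral>\<^sup>+\<omega>. ennreal ((elem_int B (k n) (\<tau> n) (\<zeta> n) t \<omega> - I t \<omega>)\<^sup>2) \<partial>M) \<longlonglongrightarrow> 0))"

definition assumption_LR :: "'a measure \<Rightarrow> (real \<Rightarrow> 'a measure) \<Rightarrow> real \<Rightarrow>
    ('a \<Rightarrow> real \<Rightarrow> real \<Rightarrow> real) \<Rightarrow> ('a \<Rightarrow> real \<Rightarrow> real \<Rightarrow> real) \<Rightarrow> bool" where
  "assumption_LR M F T L R \<longleftrightarrow>
     (\<lambda>(\<omega>,t,x). L \<omega> t x) \<in> borel_measurable (F T \<Otimes>\<^sub>M (restrict_space borel {0..T} \<Otimes>\<^sub>M borel)) \<and>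
     (\<lambda>(\<omega>,t,x). R \<omega> t x) \<in> borel_measurable (F T \<Otimes>\<^sub>M (restrict_space borel {0..T} \<Otimes>\<^sub>M borel)) \<and>
     (\<forall>\<omega>\<in>space M. \<forall>x. continuous_on {0..T} (\<lambda>t. L \<omega> t x) \<and> continuous_on {0..T} (\<lambda>t. R \<omega> t x)) \<and>
     integrable M (\<lambda>\<omega>. SUP t\<in>{0..T}. \<bar>L \<omega> t 0\<bar>) \<and>
     integrable M (\<lambda>\<omega>. SUP t\<in>{0..T}. \<bar>R \<omega> t 0\<bar>) \<and>
     (\<exists>c C. 0 < c \<and> c < C \<and> (\<forall>\<omega>\<in>space M. \<forall>t\<in>{0..T}.
        strict_mono (L \<omega> t) \<and> strict_mono (R \<omega> t) \<and>
        (\<forall>x y. c * \<bar>x - y\<bar> \<le> \<bar>L \<omega> t x - L \<omega> t y\<bar> \<and> \<bar>L \<omega> t x - L \<omega> t y\<bar> \<le> C * \<bar>x - y\<bar> \<and>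
               c * \<bar>x - y\<bar> \<le> \<bar>R \<omega> t x - R \<omega> t y\<bar> \<and> \<bar>R \<omega> t x - R \<omega> t y\<bar> \<le> C * \<bar>x - y\<bar>))) \<and>
     (\<exists>\<epsilon>>0. \<forall>\<omega>\<in>space M. \<forall>t\<in>{0..T}. \<forall>x. \<epsilon> \<le> R \<omega> t x - L \<omega> t x)"

definition assumption_f :: "'a measure \<Rightarrow> (real \<Rightarrow> 'a measure) \<Rightarrow> real \<Rightarrow>
    ('a \<Rightarrow> real \<Rightarrow> real \<Rightarrow> real \<Rightarrow> real) \<Rightarrow> bool" where
  "assumption_f M F T f \<longleftrightarrow>
     (\<forall>y z. \<forall>t\<in>{0..T}. (\<lambda>(s,\<omega>). f \<omega> s y z) \<in> borel_measurable (restrict_space borel {0..t} \<Otimes>\<^sub>M F t)) \<and>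
     (\<exists>lam. \<forall>\<omega>\<in>space M. \<forall>t\<in>{0..T}. \<forall>y z y' z'.
        \<bar>f \<omega> t y z - f \<omega> t y' z'\<bar> \<le> lam * (\<bar>y - y'\<bar> + \<bar>z - z'\<bar>)) \<and>
     (\<integral>\<^sup>+\<omega>. (\<integral>\<^sup>+t\<in>{0..T}. ennreal ((f \<omega> t 0 0)\<^sup>2) \<partial>lborel) \<partial>M) < \<infinity>"

text \<open>Lebesgue-Stieltjes integral int_0^T g dK for K in I[0,T] (K extended constantly outside [0,T]).\<close>
definition stieltjes_int :: "real \<Rightarrow> (real \<Rightarrow> real) \<Rightarrow> (real \<Rightarrow> real) \<Rightarrow> real" where
  "stieltjes_int T K g = set_lebesgue_integral (interval_measure (\<lambda>t. K (max 0 (min t T)))) {0..T} g"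

definition solves_P :: "'a measure \<Rightarrow> (real \<Rightarrow> 'a measure) \<Rightarrow> (real \<Rightarrow> 'a \<Rightarrow> real) \<Rightarrow> real \<Rightarrow>
    ('a \<Rightarrow> real) \<Rightarrow> ('a \<Rightarrow> real \<Rightarrow> real \<Rightarrow> real \<Rightarrow> real) \<Rightarrow>
    ('a \<Rightarrow> real \<Rightarrow> real \<Rightarrow> real) \<Rightarrow> ('a \<Rightarrow> real \<Rightarrow> real \<Rightarrow> real) \<Rightarrow>
    (real \<Rightarrow> 'a \<Rightarrow> real) \<Rightarrow> (real \<Rightarrow> 'a \<Rightarrow> real) \<Rightarrow> (real \<Rightarrow> real) \<Rightarrow> bool" where
  "solves_P M F B T \<xi> f L R Y Z K \<longleftrightarrow>
     in_S2 M F T Y \<and> in_H2 M F T Z \<and>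
     (\<exists>I. is_ito_integral M F B T Z I \<and>
        (\<forall>t\<in>{0..T}. AE \<omega> in M.
           Y t \<omega> = \<xi> \<omega> + set_lebesgue_integral lborel {t..T} (\<lambda>s. f \<omega> s (Y s \<omega>) (Z s \<omega>))
                    - (I T \<omega> - I t \<omega>) + K T - K t)) \<and>
     (\<forall>t\<in>{0..T}. (\<integral>\<omega>. L \<omega> t (Y t \<omega>) \<partial>M) \<le> 0 \<and> 0 \<le> (\<integral>\<omega>. R \<omega> t (Y t \<omega>) \<partial>M)) \<and>
     (\<exists>KR KL. in_I T KR \<and> in_I T KL \<and> (\<forall>t\<in>{0..T}. K t = KR t - KL t) \<and>
        stieltjes_int T KR (\<lambda>t. \<integral>\<omega>. R \<omega> t (Y t \<omega>) \<partial>M) = 0 \<and>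
        stieltjes_int T KL (\<lambda>t. \<integral>\<omega>. L \<omega> t (Y t \<omega>) \<partial>M) = 0)"

end

theory Submission
  imports Defs
begin

text \<open>
  The Ito integral has mean-zero increments given the past, so
  Ybar differs from Y by the deterministic amount K T - K t.  Hence rbar and lbar are the levels of
  the mean of Y at which the constraints become binding, the constraints say rbar \<le> E Y \<le> lbar, and
  every payoff J t s q is a function of E Y, K, rbar and lbar.  Let q0 (s0) be the first time after t at which the
  constraint for R (for L) is binding, or T.  By the Skorokhod conditions KR is flat on [t, q0] and
  KL is flat on [t, s0], which makes (s0, q0) a saddle point with value E (Y t).
\<close>

subsection \<open>Brownian increments and the Ito integral\<close>

text \<open>The Ito integral is given only as an L2 limit of elementary integrals at each fixed
  time, so no martingale property is at hand. It is rebuilt from independence of Brownian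
  increments: for cylinder events, for the augmented filtration, for bounded integrands, and in the
  limit. The second obstacle is that Lebesgue integrals default to 0 for non-integrable functions,
  so every splitting of an expectation or of a path integral needs an integrability proof. For the
  drift up to \<open>T\<close> the equation itself supplies it: all other terms are integrable, and
  completeness of \<open>M\<close> turns almost sure equality into measurability. For the drift up
  to an earlier time one subtracts two such drifts, which requires almost every path of the driver
  to be integrable; the joint measurability of \<open>f\<close> and \<open>Z\<close> and the
  Lipschitz condition serve this purpose.\<close>

lemma space_aug_nat_filtration [simp]: "space (aug_nat_filtration M B t) = space M"
  by (simp add: aug_nat_filtration_def space_measure_of_conv)

lemma sets_aug_nat_filtration:
  "sets (aug_nat_filtration M B t) = sigma_sets (space M)
     ({B s -` A \<inter> space M | s A. 0 \<le> s \<and> s \<le> t \<and> A \<in> sets borel} \<union> null_sets M)"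
  unfolding aug_nat_filtration_def
  by (rule sets_measure_of) (auto dest: null_setsD2 sets.sets_into_space)

lemma subalgebra_aug_nat_filtration:
  assumes "std_brownian_motion M B"
  shows "subalgebra M (aug_nat_filtration M B t)"
proof -
  have B: "B s \<in> borel_measurable M" for s
    using assms by (auto simp: std_brownian_motion_def)
  have "{B s -` A \<inter> space M | s A. 0 \<le> s \<and> s \<le> t \<and> A \<in> sets borel} \<union> null_sets M \<subseteq> sets M"
    using measurable_sets[OF B] by auto
  then show ?thesis
    unfolding subalgebra_def sets_aug_nat_filtration by (simp add: sets.sigma_sets_subset)
qed

lemma sets_aug_nat_filtration_mono:
  "s \<le> t \<Longrightarrow> sets (aug_nat_filtration M B s) \<subseteq> sets (aug_nat_filtration M B t)"
  unfolding sets_aug_nat_filtration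
  by (intro sigma_sets_mono' Un_mono subset_refl) (blast intro: order_trans)

lemma measurable_aug_nat_filtration_mono:
  "s \<le> t \<Longrightarrow> X \<in> measurable (aug_nat_filtration M B s) N \<Longrightarrow> X \<in> measurable (aug_nat_filtration M B t) N"
  using sets_aug_nat_filtration_mono[of s t M B] unfolding measurable_def by fastforce

text \<open>Independence of Brownian increments is postulated only along infinite strictly
  increasing sequences of times, so a finite set of past times has to be embedded in one. Starting
  at 0 makes every past value of \<open>B\<close> a sum of increments; having \<open>s\<close> and
  \<open>u\<close> adjacent makes the future increment a single member of the family.\<close>

lemma strict_mono_enumeration_extending_finite_set:
  fixes S :: "real set"
  assumes "finite S" "0 \<in> S" "s \<in> S" "S \<subseteq> {0..s}" "s < u"
  obtains n and \<tau> :: "nat \<Rightarrow> real"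
  where "strict_mono \<tau>" "\<tau> 0 = 0" "\<tau> n = s" "\<tau> (Suc n) = u" "\<And>r. r \<in> S \<Longrightarrow> \<exists>j\<le>n. \<tau> j = r"
proof -
  define xs where "xs = sorted_list_of_set S"
  define m where "m = length xs"
  \<comment> \<open>At \<open>i = m\<close> the tail starts with \<open>u\<close>, since
    \<open>m - m = 0\<close>; its later unit steps only keep the sequence strictly
    increasing.\<close>
  define \<tau> where "\<tau> i = (if i < m then xs ! i else u + real (i - m))" for i
  have set: "set xs = S" and sorted: "sorted_wrt (<) xs"
    using assms by (auto simp: xs_def)
  have mem: "xs ! i \<in> S" if "i < m" for i
    using that nth_mem[of i xs] set by (simp add: m_def)
  have "\<tau> i < \<tau> (Suc i)" for i
  proof (cases "Suc i < m")
    case True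
    then show ?thesis
      using sorted by (simp add: \<tau>_def m_def sorted_wrt_iff_nth_less)
  next
    case False
    then show ?thesis
      using mem[of i] assms by (cases "i < m") (auto simp: \<tau>_def)
  qed
  then have mono: "strict_mono \<tau>" by (simp add: strict_mono_Suc_iff)
  have idx: "\<exists>j<m. \<tau> j = r" if "r \<in> S" for r
  proof -
    have "r \<in> set xs" using that set by simp
    then obtain j where "j < length xs" "xs ! j = r" unfolding in_set_conv_nth by blast
    then show ?thesis by (intro exI[of _ j]) (simp add: \<tau>_def m_def)
  qed
  obtain i0 where i0: "i0 < m" "\<tau> i0 = 0" using idx[OF \<open>0 \<in> S\<close>] by blast
  obtain n where n: "n < m" "\<tau> n = s" using idx[OF \<open>s \<in> S\<close>] by blast
  have in_S: "\<tau> i \<in> S" if "i < m" for i using mem[OF that] that by (simp add: \<tau>_def)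
  have "\<tau> 0 = 0"
    using in_S[of 0] i0 assms strict_mono_leD[OF mono, of 0 i0] by fastforce
  moreover have last: "j \<le> n" if "j < m" for j
    using in_S[OF that] n assms strict_mono_less_eq[OF mono, of j n] by force
  moreover have "Suc n = m"
    using last[of "m - 1"] n by linarith
  then have "\<tau> (Suc n) = u" by (simp add: \<tau>_def)
  ultimately show ?thesis
    using that[of \<tau> n] mono n idx by blast
qed

section \<open>Orthogonality of Brownian increments to the past\<close>

locale brownian = prob_space M for M :: "'a measure" +
  fixes B :: "real \<Rightarrow> 'a \<Rightarrow> real"
  assumes bm: "std_brownian_motion M B"
begin

abbreviation Fil :: "real \<Rightarrow> 'a measure" where "Fil \<equiv> aug_nat_filtration M B"

lemma B_measurable [measurable]: "B t \<in> borel_measurable M"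
  using bm by (simp add: std_brownian_motion_def)

lemma subalgebra_Fil: "subalgebra M (Fil t)"
  by (rule subalgebra_aug_nat_filtration[OF bm])

lemma sets_Fil_imp_sets: "A \<in> sets (Fil t) \<Longrightarrow> A \<in> sets M"
  using subalgebra_Fil by (auto simp: subalgebra_def)

lemma measurable_Fil_imp_measurable: "X \<in> borel_measurable (Fil t) \<Longrightarrow> X \<in> borel_measurable M"
  by (rule measurable_from_subalg[OF subalgebra_Fil])

lemma increment:
  assumes "0 \<le> s" "s \<le> t"
  shows integrable_increment: "integrable M (\<lambda>\<omega>. B t \<omega> - B s \<omega>)"
    and expectation_increment: "expectation (\<lambda>\<omega>. B t \<omega> - B s \<omega>) = 0"
proof -
  have "integrable M (\<lambda>\<omega>. B t \<omega> - B s \<omega>) \<and> expectation (\<lambda>\<omega>. B t \<omega> - B s \<omega>) = 0"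
  \<comment> \<open>The normal law is postulated for distinct times only; for equal times the
    increment is identically zero.\<close>
  proof (cases "s = t")
    case False
    with assms have pos: "0 < sqrt (t - s)" by simp
    have D: "distributed M lborel (\<lambda>\<omega>. B t \<omega> - B s \<omega>) (\<lambda>x. ennreal (normal_density 0 (sqrt (t - s)) x))"
      using bm assms False by (auto simp: std_brownian_motion_def)
    show ?thesis
      using distributed_integrable_var[OF D] integrable_normal_moment_nz_1[OF pos]
        normal_distributed_expectation[OF pos D] by simp
  qed simp
  then show "integrable M (\<lambda>\<omega>. B t \<omega> - B s \<omega>)" "expectation (\<lambda>\<omega>. B t \<omega> - B s \<omega>) = 0" by auto
qed

text \<open>Each \<open>B r\<close> with \<open>r\<close> in \<open>I\<close> telescopes into
  increments that precede the one from \<open>s\<close> to \<open>u\<close>. The indicator is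
  therefore independent of that increment, and the expectation factors with a factor 0.\<close>

lemma increment_orthogonal_cylinder:
  assumes "finite I" "I \<subseteq> {0..s}" "0 \<le> s" "s < u" and A: "\<And>r. r \<in> I \<Longrightarrow> A r \<in> sets borel"
  shows "expectation (\<lambda>\<omega>. indicator {\<omega>\<in>space M. \<forall>r\<in>I. B r \<omega> \<in> A r} \<omega> * (B u \<omega> - B s \<omega>)) = 0"
proof -
  obtain n \<tau> where \<tau>: "strict_mono \<tau>" "\<tau> 0 = 0" "\<tau> n = s" "\<tau> (Suc n) = u"
    and ex: "\<And>r. r \<in> I \<Longrightarrow> \<exists>j\<le>n. \<tau> j = r"
  proof (rule strict_mono_enumeration_extending_finite_set)
    show "finite (insert 0 (insert s I))" "0 \<in> insert 0 (insert s I)" "s \<in> insert 0 (insert s I)"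
      "insert 0 (insert s I) \<subseteq> {0..s}" "s < u" using assms by auto
  qed blast
  obtain j where j: "\<And>r. r \<in> I \<Longrightarrow> j r \<le> n \<and> \<tau> (j r) = r" using ex by metis
  define D where "D i \<omega> = B (\<tau> (Suc i)) \<omega> - B (\<tau> i) \<omega>" for i \<omega>
  have ind: "indep_vars (\<lambda>_. borel) D UNIV"
    using bm \<tau> unfolding std_brownian_motion_def D_def by fastforce
  have sumD: "(\<Sum>i<k. D i \<omega>) = B (\<tau> k) \<omega>" if "\<omega> \<in> space M" for k \<omega>
    using bm that \<tau>(2) sum_lessThan_telescope[of "\<lambda>i. B (\<tau> i) \<omega>" k]
    by (simp add: D_def std_brownian_motion_def)
  \<comment> \<open>The indicator of the cylinder as a function of the first \<open>n\<close>
    increments; the increment of index \<open>n\<close> is the one from \<open>s\<close> to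
    \<open>u\<close>.\<close>
  define Y1 :: "(nat \<Rightarrow> real) \<Rightarrow> real"
    where "Y1 h = indicator {h \<in> space (PiM {..<n} (\<lambda>_. borel)). \<forall>r\<in>I. (\<Sum>i<j r. h i) \<in> A r} h" for h
  have meas_sum: "(\<lambda>h. \<Sum>i<j r. h i) \<in> borel_measurable (PiM {..<n} (\<lambda>_. borel::real measure))" if "r \<in> I" for r
    using j[OF that] by (intro borel_measurable_sum measurable_component_singleton) auto
  have "{h \<in> space (PiM {..<n} (\<lambda>_. borel::real measure)). \<forall>r\<in>I. (\<Sum>i<j r. h i) \<in> A r} \<in> sets (PiM {..<n} (\<lambda>_. borel))"
  proof (rule sets.sets_Collect_finite_All[OF _ \<open>finite I\<close>])
    fix r assume "r \<in> I"
    from measurable_sets[OF meas_sum[OF this] A[OF this]]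
    show "{h \<in> space (PiM {..<n} (\<lambda>_. borel::real measure)). (\<Sum>i<j r. h i) \<in> A r} \<in> sets (PiM {..<n} (\<lambda>_. borel))"
      by (simp add: vimage_def Int_def conj_commute)
  qed
  then have Y1: "Y1 \<in> borel_measurable (PiM {..<n} (\<lambda>_. borel))"
    unfolding Y1_def by simp
  have "indep_var borel (Y1 \<circ> (\<lambda>\<omega>. restrict (\<lambda>i. D i \<omega>) {..<n})) borel ((\<lambda>h. h n) \<circ> (\<lambda>\<omega>. restrict (\<lambda>i. D i \<omega>) {n}))"
    by (rule indep_var_compose[OF indep_var_restrict[OF ind]]) (use Y1 in auto)
  then have iv: "indep_var borel (\<lambda>\<omega>. Y1 (restrict (\<lambda>i. D i \<omega>) {..<n})) borel (D n)"
    by (simp add: comp_def)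
  have Dn: "D n = (\<lambda>\<omega>. B u \<omega> - B s \<omega>)" using \<tau> by (auto simp: D_def)
  have intD: "integrable M (D n)" unfolding Dn using integrable_increment assms by simp
  have "expectation (\<lambda>\<omega>. indicator {\<omega>\<in>space M. \<forall>r\<in>I. B r \<omega> \<in> A r} \<omega> * (B u \<omega> - B s \<omega>))
      = expectation (\<lambda>\<omega>. Y1 (restrict (\<lambda>i. D i \<omega>) {..<n}) * D n \<omega>)"
  proof (rule Bochner_Integration.integral_cong[OF refl])
    fix \<omega> assume w: "\<omega> \<in> space M"
    have "(\<Sum>i<j r. restrict (\<lambda>i. D i \<omega>) {..<n} i) = B r \<omega>" if "r \<in> I" for r
    proof -
      have "(\<Sum>i<j r. restrict (\<lambda>i. D i \<omega>) {..<n} i) = (\<Sum>i<j r. D i \<omega>)"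
        using j[OF that] by (intro sum.cong) auto
      then show ?thesis using sumD[OF w] j[OF that] by simp
    qed
    then have "Y1 (restrict (\<lambda>i. D i \<omega>) {..<n}) = indicator {\<omega>\<in>space M. \<forall>r\<in>I. B r \<omega> \<in> A r} \<omega>"
      using w by (auto simp: Y1_def indicator_def space_PiM)
    then show "indicator {\<omega>\<in>space M. \<forall>r\<in>I. B r \<omega> \<in> A r} \<omega> * (B u \<omega> - B s \<omega>) = Y1 (restrict (\<lambda>i. D i \<omega>) {..<n}) * D n \<omega>"
      by (simp add: Dn)
  qed
  also have "\<dots> = expectation (\<lambda>\<omega>. Y1 (restrict (\<lambda>i. D i \<omega>) {..<n})) * expectation (D n)"
  proof (rule indep_var_lebesgue_integral[OF iv])
    show "integrable M (\<lambda>\<omega>. Y1 (restrict (\<lambda>i. D i \<omega>) {..<n}))"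
      using indep_var_rv1[OF iv]
      by (intro integrable_const_bound[where B=1]) (auto simp: Y1_def)
  qed (rule intD)
  also have "\<dots> = 0"
    using expectation_increment[of s u] assms by (simp add: Dn)
  finally show ?thesis .
qed

text \<open>Cylinders over finitely many times form an intersection-stable generator. The events
  orthogonal to the increment are closed under countable disjoint unions, and under complements
  because the increment has mean zero.\<close>

lemma increment_orthogonal_natural:
  assumes "0 \<le> s" "s < u"
    and A: "A \<in> sigma_sets (space M) {B r -` C \<inter> space M | r C. 0 \<le> r \<and> r \<le> s \<and> C \<in> sets borel}"
  shows "expectation (\<lambda>\<omega>. indicator A \<omega> * (B u \<omega> - B s \<omega>)) = 0"
proof -
  let ?G = "{B r -` C \<inter> space M | r C. 0 \<le> r \<and> r \<le> s \<and> C \<in> sets borel}"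
  define P where "P = {{\<omega>\<in>space M. \<forall>r\<in>I. B r \<omega> \<in> C r} | I C. finite I \<and> I \<subseteq> {0..s} \<and> (\<forall>r\<in>I. C r \<in> sets (borel::real measure))}"
  have "?G \<subseteq> P"
  proof
    fix X assume "X \<in> ?G"
    then obtain r C where "X = {\<omega>\<in>space M. \<forall>r'\<in>{r}. B r' \<omega> \<in> C}" "0 \<le> r" "r \<le> s" "C \<in> sets borel"
      by auto
    then show "X \<in> P" unfolding P_def by (intro CollectI exI[of _ "{r}"] exI[of _ "\<lambda>_. C"]) auto
  qed
  then have AP: "A \<in> sigma_sets (space M) P" using A sigma_sets_mono' by blast
  have P_sets: "P \<subseteq> sets M"
  proof
    fix X assume "X \<in> P"
    then obtain I C where X: "X = {\<omega>\<in>space M. \<forall>r\<in>I. B r \<omega> \<in> C r}" "finite I" "\<forall>r\<in>I. C r \<in> sets borel"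
      by (auto simp: P_def)
    show "X \<in> sets M" unfolding X
    proof (rule sets.sets_Collect_finite_All[OF _ X(2)])
      fix r assume "r \<in> I"
      with X have "B r -` C r \<inter> space M \<in> sets M" by (intro measurable_sets[OF B_measurable]) auto
      then show "{\<omega> \<in> space M. B r \<omega> \<in> C r} \<in> sets M" by (simp add: vimage_def Int_def conj_commute)
    qed
  qed
  have "Int_stable P"
  proof (rule Int_stableI)
    fix X X' assume "X \<in> P" "X' \<in> P"
    then obtain I C I' C' where X: "X = {\<omega>\<in>space M. \<forall>r\<in>I. B r \<omega> \<in> C r}" "finite I" "I \<subseteq> {0..s}" "\<forall>r\<in>I. C r \<in> sets borel"
      and X': "X' = {\<omega>\<in>space M. \<forall>r\<in>I'. B r \<omega> \<in> C' r}" "finite I'" "I' \<subseteq> {0..s}" "\<forall>r\<in>I'. C' r \<in> sets borel"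
      by (auto simp: P_def)
    \<comment> \<open>A time that occurs in only one of the two cylinders is constrained by
      \<open>UNIV\<close> in the other.\<close>
    define E where "E r = (if r \<in> I then C r else UNIV) \<inter> (if r \<in> I' then C' r else UNIV)" for r
    have "X \<inter> X' = {\<omega>\<in>space M. \<forall>r\<in>I \<union> I'. B r \<omega> \<in> E r}"
      by (auto simp: X X' E_def split: if_splits)
    moreover have "\<forall>r\<in>I \<union> I'. E r \<in> sets borel" using X X' by (auto simp: E_def)
    ultimately show "X \<inter> X' \<in> P" unfolding P_def
      using X X' by (intro CollectI exI[of _ "I \<union> I'"] exI[of _ E]) auto
  qed
  have "P \<subseteq> Pow (space M)" by (auto simp: P_def)
  have int: "integrable M (\<lambda>\<omega>. indicator X \<omega> * (B u \<omega> - B s \<omega>))" if "X \<in> sets M" for X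
    using integrable_mult_indicator[OF that integrable_increment, of s u] assms by simp
  have sets_P: "sigma_sets (space M) P \<subseteq> sets M"
    by (rule sets.sigma_sets_subset[OF P_sets])
  from \<open>Int_stable P\<close> \<open>P \<subseteq> Pow (space M)\<close> AP show ?thesis
  proof (induct rule: sigma_sets_induct_disjoint)
    case (basic X)
    then show ?case
      using increment_orthogonal_cylinder assms by (auto simp: P_def)
  next
    case empty
    then show ?case by simp
  next
    case (compl X)
    have X: "X \<in> sets M" using compl sets_P by auto
    have "expectation (\<lambda>\<omega>. indicator (space M - X) \<omega> * (B u \<omega> - B s \<omega>))
        = expectation (\<lambda>\<omega>. (B u \<omega> - B s \<omega>) - indicator X \<omega> * (B u \<omega> - B s \<omega>))"
      by (intro Bochner_Integration.integral_cong) (auto simp: indicator_def)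
    also have "\<dots> = 0"
      using int[OF X] integrable_increment[of s u] expectation_increment[of s u] assms compl
      by (subst Bochner_Integration.integral_diff) auto
    finally show ?case .
  next
    case (union X)
    have X: "X i \<in> sets M" for i using union sets_P by auto
    have "set_integrable M (\<Union>i. X i) (\<lambda>\<omega>. B u \<omega> - B s \<omega>)"
      using int[of "\<Union>i. X i"] X by (simp add: set_integrable_def)
    then have "(LINT \<omega>:(\<Union>i. X i)|M. B u \<omega> - B s \<omega>) = (\<Sum>i. (LINT \<omega>:X i|M. B u \<omega> - B s \<omega>))"
      using X union(1) by (intro lebesgue_integral_countable_add) (auto simp: disjoint_family_on_def)
    also have "\<dots> = 0" using union(3) by (simp add: set_lebesgue_integral_def)
    finally show ?case by (simp add: set_lebesgue_integral_def)
  qed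
qed

text \<open>Augmentation adds only null sets, each equivalent to the empty set, and almost sure
  equality survives complements and countable unions. Expectations do not see the difference, so
  orthogonality carries over to the augmented filtration.\<close>

lemma Fil_AE_eq_natural:
  assumes "A \<in> sets (Fil s)"
  shows "\<exists>A'\<in>sigma_sets (space M) {B r -` C \<inter> space M | r C. 0 \<le> r \<and> r \<le> s \<and> C \<in> sets borel}.
           AE \<omega> in M. \<omega> \<in> A \<longleftrightarrow> \<omega> \<in> A'"
  using assms unfolding sets_aug_nat_filtration
proof (induct rule: sigma_sets.induct)
  case (Basic X)
  then consider "X \<in> {B r -` C \<inter> space M | r C. 0 \<le> r \<and> r \<le> s \<and> C \<in> sets borel}" | "X \<in> null_sets M"
    by blast
  then show ?case
  proof cases
    case 1
    then show ?thesis by (intro bexI[of _ X] sigma_sets.Basic) auto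
  next
    case 2
    then show ?thesis
      using AE_not_in[OF 2] by (intro bexI[of _ "{}"] sigma_sets.Empty) auto
  qed
next
  case Empty
  show ?case by (intro bexI[of _ "{}"] sigma_sets.Empty) auto
next
  case (Compl X)
  then obtain X' where X': "X' \<in> sigma_sets (space M) {B r -` C \<inter> space M | r C. 0 \<le> r \<and> r \<le> s \<and> C \<in> sets borel}"
    "AE \<omega> in M. \<omega> \<in> X \<longleftrightarrow> \<omega> \<in> X'" by blast
  have "AE \<omega> in M. \<omega> \<in> space M - X \<longleftrightarrow> \<omega> \<in> space M - X'"
    using X'(2) by eventually_elim simp
  then show ?case
    by (rule bexI) (intro sigma_sets.Compl X'(1))
next
  case (Union X)
  have "\<forall>i. \<exists>X'. X' \<in> sigma_sets (space M) {B r -` C \<inter> space M | r C. 0 \<le> r \<and> r \<le> s \<and> C \<in> sets borel} \<and>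
      (AE \<omega> in M. \<omega> \<in> X i \<longleftrightarrow> \<omega> \<in> X')"
    using Union(2) by blast
  then obtain X' where X': "\<And>i::nat. X' i \<in> sigma_sets (space M) {B r -` C \<inter> space M | r C. 0 \<le> r \<and> r \<le> s \<and> C \<in> sets borel}"
    "\<And>i. AE \<omega> in M. \<omega> \<in> X i \<longleftrightarrow> \<omega> \<in> X' i"
    by (auto dest!: choice)
  have "AE \<omega> in M. \<forall>i. \<omega> \<in> X i \<longleftrightarrow> \<omega> \<in> X' i" using X'(2) by (simp add: AE_all_countable)
  then have "AE \<omega> in M. \<omega> \<in> (\<Union>i. X i) \<longleftrightarrow> \<omega> \<in> (\<Union>i. X' i)"
    by eventually_elim simp
  then show ?case
    by (rule bexI) (intro sigma_sets.Union X'(1))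
qed

lemma increment_orthogonal_set:
  assumes "0 \<le> s" "s \<le> u" "A \<in> sets (Fil s)"
  shows "expectation (\<lambda>\<omega>. indicator A \<omega> * (B u \<omega> - B s \<omega>)) = 0"
proof (cases "s = u")
  case False
  with assms have "s < u" by simp
  let ?N = "sigma_sets (space M) {B r -` C \<inter> space M | r C. 0 \<le> r \<and> r \<le> s \<and> C \<in> sets borel}"
  obtain A' where A': "A' \<in> ?N" "AE \<omega> in M. \<omega> \<in> A \<longleftrightarrow> \<omega> \<in> A'"
    using Fil_AE_eq_natural[OF assms(3)] by blast
  have "?N \<subseteq> sets M"
    by (rule sets.sigma_sets_subset) (auto intro!: measurable_sets[OF B_measurable])
  then have [measurable]: "A \<in> sets M" "A' \<in> sets M"
    using A' sets_Fil_imp_sets[OF assms(3)] by auto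
  have "expectation (\<lambda>\<omega>. indicator A \<omega> * (B u \<omega> - B s \<omega>)) = expectation (\<lambda>\<omega>. indicator A' \<omega> * (B u \<omega> - B s \<omega>))"
    using A'(2) by (intro integral_cong_AE) (auto simp: indicator_def)
  then show ?thesis
    using increment_orthogonal_natural[OF assms(1) \<open>s < u\<close> A'(1)] by simp
qed simp

text \<open>Orthogonality to indicators says that the increment has conditional expectation zero,
  and a factor known at time \<open>s\<close> can be pulled out. Boundedness of \<open>X\<close>
  provides the integrability of the product.\<close>

lemma increment_orthogonal:
  assumes "0 \<le> s" "s \<le> u" and X: "X \<in> borel_measurable (Fil s)" and bound: "\<And>\<omega>. \<omega> \<in> space M \<Longrightarrow> \<bar>X \<omega>\<bar> \<le> C"
  shows "integrable M (\<lambda>\<omega>. X \<omega> * (B u \<omega> - B s \<omega>))"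
    and "expectation (\<lambda>\<omega>. X \<omega> * (B u \<omega> - B s \<omega>)) = 0"
proof -
  interpret sub: finite_measure_subalgebra M "Fil s"
    by unfold_locales (rule subalgebra_Fil)
  have [measurable]: "X \<in> borel_measurable M" by (rule measurable_Fil_imp_measurable[OF X])
  show int: "integrable M (\<lambda>\<omega>. X \<omega> * (B u \<omega> - B s \<omega>))"
  proof (rule Bochner_Integration.integrable_bound)
    show "integrable M (\<lambda>\<omega>. C * (B u \<omega> - B s \<omega>))" using integrable_increment assms by simp
    show "AE \<omega> in M. norm (X \<omega> * (B u \<omega> - B s \<omega>)) \<le> norm (C * (B u \<omega> - B s \<omega>))"
      using bound by (intro AE_I2) (force simp: abs_mult intro!: mult_right_mono)
  qed measurable
  have 0: "AE \<omega> in M. real_cond_exp M (Fil s) (\<lambda>\<omega>. B u \<omega> - B s \<omega>) \<omega> = 0"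
    by (rule sub.real_cond_exp_charact)
       (use increment_orthogonal_set[OF assms(1,2)] integrable_increment[OF assms(1,2)] in \<open>auto simp: set_lebesgue_integral_def\<close>)
  have "expectation (\<lambda>\<omega>. X \<omega> * (B u \<omega> - B s \<omega>)) = expectation (\<lambda>\<omega>. X \<omega> * real_cond_exp M (Fil s) (\<lambda>\<omega>. B u \<omega> - B s \<omega>) \<omega>)"
    by (rule sub.real_cond_exp_intg(2)[symmetric, OF int X]) measurable
  also have "\<dots> = expectation (\<lambda>_. 0)"
    using 0 borel_measurable_cond_exp2 by (intro integral_cong_AE) auto
  finally show "expectation (\<lambda>\<omega>. X \<omega> * (B u \<omega> - B s \<omega>)) = 0" by simp
qed

end

section \<open>From elementary integrals to the Ito integral\<close>

lemma (in prob_space) expectation_abs_le_of_L2: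
  fixes U :: "'a \<Rightarrow> real"
  assumes [measurable]: "U \<in> borel_measurable M" and "0 < e"
    and L2: "(\<integral>\<^sup>+\<omega>. ennreal ((U \<omega>)\<^sup>2) \<partial>M) < ennreal (e\<^sup>2)"
  shows "integrable M U" and "expectation (\<lambda>\<omega>. \<bar>U \<omega>\<bar>) \<le> e"
proof -
  have sq: "integrable M (\<lambda>\<omega>. (U \<omega>)\<^sup>2)"
    using L2 by (intro integrableI_bounded) (auto intro: less_trans)
  show "integrable M U"
    by (rule square_integrable_imp_integrable[OF _ sq]) measurable
  then have int: "integrable M (\<lambda>\<omega>. \<bar>U \<omega>\<bar>)" by simp
  have "ennreal (expectation (\<lambda>\<omega>. (U \<omega>)\<^sup>2)) < ennreal (e\<^sup>2)"
    using L2 nn_integral_eq_integral[OF sq] by simp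
  then have le: "expectation (\<lambda>\<omega>. (U \<omega>)\<^sup>2) \<le> e\<^sup>2"
    by (simp add: ennreal_less_iff)
  \<comment> \<open>Young's inequality, from (\<bar>U\<bar> - e)^2 \<ge> 0, with weights chosen so
    that a second moment of at most e^2 makes each summand contribute at most e / 2.\<close>
  have "expectation (\<lambda>\<omega>. \<bar>U \<omega>\<bar>) \<le> expectation (\<lambda>\<omega>. e / 2 + (U \<omega>)\<^sup>2 / (2 * e))"
  proof (rule integral_mono[OF int])
    show "integrable M (\<lambda>\<omega>. e / 2 + (U \<omega>)\<^sup>2 / (2 * e))" using sq by simp
    fix \<omega>
    have "0 \<le> (\<bar>U \<omega>\<bar> - e)\<^sup>2" by simp
    then have "2 * e * \<bar>U \<omega>\<bar> \<le> e\<^sup>2 + (U \<omega>)\<^sup>2" by (simp add: power2_diff algebra_simps)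
    then show "\<bar>U \<omega>\<bar> \<le> e / 2 + (U \<omega>)\<^sup>2 / (2 * e)"
      using \<open>0 < e\<close> by (simp add: field_simps power2_eq_square)
  qed
  also have "\<dots> = e / 2 + expectation (\<lambda>\<omega>. (U \<omega>)\<^sup>2) / (2 * e)"
    using sq by (simp add: prob_space)
  also have "\<dots> \<le> e / 2 + e\<^sup>2 / (2 * e)"
    using le \<open>0 < e\<close> by (intro add_left_mono divide_right_mono) auto
  also have "\<dots> = e" using \<open>0 < e\<close> by (simp add: field_simps power2_eq_square)
  finally show "expectation (\<lambda>\<omega>. \<bar>U \<omega>\<bar>) \<le> e" .
qed

lemma simple_pred_mono:
  assumes "simple_pred M F T k \<tau> \<zeta>" "i \<le> j" "j \<le> k"
  shows "\<tau> i \<le> \<tau> j"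
  using assms(2,3)
proof (induct rule: dec_induct)
  case (step n)
  then have "\<tau> n \<le> \<tau> (Suc n)" using assms(1) by (auto simp: simple_pred_def)
  with step show ?case by simp
qed simp

context brownian
begin

lemma integrable_elem_int:
  assumes sp: "simple_pred M Fil T k \<tau> \<zeta>" and "0 \<le> t"
  shows "integrable M (elem_int B k \<tau> \<zeta> t)"
proof -
  have "integrable M (\<lambda>\<omega>. \<zeta> i \<omega> * (B (min (\<tau> (Suc i)) t) \<omega> - B (min (\<tau> i) t) \<omega>))" if "i < k" for i
  proof (cases "\<tau> i \<le> t")
    case True
    have *: "0 \<le> \<tau> 0" "\<tau> 0 \<le> \<tau> i" "\<tau> i \<le> \<tau> (Suc i)" "\<zeta> i \<in> borel_measurable (Fil (\<tau> i))"
      using sp that simple_pred_mono[OF sp, of 0 i] by (auto simp: simple_pred_def)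
    obtain C where "\<And>\<omega>. \<omega> \<in> space M \<Longrightarrow> \<bar>\<zeta> i \<omega>\<bar> \<le> C" using sp \<open>i < k\<close> unfolding simple_pred_def by blast
    with increment_orthogonal(1)[of "\<tau> i" "min (\<tau> (Suc i)) t" "\<zeta> i" C] * True
    show ?thesis by (simp add: min_absorb1)
  next
    case False
    \<comment> \<open>An interval that starts after \<open>t\<close> has both end points cut down to
      \<open>t\<close>, so its term vanishes.\<close>
    then have "min (\<tau> (Suc i)) t = min (\<tau> i) t" using sp that by (auto simp: simple_pred_def)
    then show ?thesis by simp
  qed
  then show ?thesis unfolding elem_int_def by (intro Bochner_Integration.integrable_sum) auto
qed

text \<open>Raising all partition times to at least \<open>t\<close> turns the increment of the
  integral into a sum over the times \<open>max (\<tau> i) t\<close>. At such a time both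
  \<open>A\<close> and \<open>\<zeta> i\<close> are known, so every summand has mean zero.\<close>

lemma elem_int_orthogonal:
  assumes sp: "simple_pred M Fil T k \<tau> \<zeta>" and t: "t \<in> {0..T}" and A: "A \<in> sets (Fil t)"
  shows "expectation (\<lambda>\<omega>. indicator A \<omega> * (elem_int B k \<tau> \<zeta> T \<omega> - elem_int B k \<tau> \<zeta> t \<omega>)) = 0"
proof -
  define X where "X i \<omega> = indicator A \<omega> * \<zeta> i \<omega>" for i \<omega>
  have X: "integrable M (\<lambda>\<omega>. X i \<omega> * (B (max (\<tau> (Suc i)) t) \<omega> - B (max (\<tau> i) t) \<omega>)) \<and>
      expectation (\<lambda>\<omega>. X i \<omega> * (B (max (\<tau> (Suc i)) t) \<omega> - B (max (\<tau> i) t) \<omega>)) = 0" if "i < k" for i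
  proof -
    have *: "\<tau> i \<le> \<tau> (Suc i)" "\<zeta> i \<in> borel_measurable (Fil (\<tau> i))"
      using sp that by (auto simp: simple_pred_def)
    obtain C where C: "\<And>\<omega>. \<omega> \<in> space M \<Longrightarrow> \<bar>\<zeta> i \<omega>\<bar> \<le> C" using sp \<open>i < k\<close> unfolding simple_pred_def by blast
    have [measurable]: "\<zeta> i \<in> borel_measurable (Fil (max (\<tau> i) t))"
      by (rule measurable_aug_nat_filtration_mono[OF _ *(2)]) simp
    have [measurable]: "A \<in> sets (Fil (max (\<tau> i) t))"
      using sets_aug_nat_filtration_mono[of t "max (\<tau> i) t" M B] A by auto
    have "X i \<in> borel_measurable (Fil (max (\<tau> i) t))" unfolding X_def by measurable
    moreover have "\<bar>X i \<omega>\<bar> \<le> \<bar>C\<bar>" if "\<omega> \<in> space M" for \<omega>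
      using C[OF that] by (auto simp: X_def indicator_def)
    moreover have "0 \<le> max (\<tau> i) t" "max (\<tau> i) t \<le> max (\<tau> (Suc i)) t"
      using t *(1) by auto
    ultimately show ?thesis using increment_orthogonal by blast
  qed
  have "indicator A \<omega> * (elem_int B k \<tau> \<zeta> T \<omega> - elem_int B k \<tau> \<zeta> t \<omega>)
      = (\<Sum>i<k. X i \<omega> * (B (max (\<tau> (Suc i)) t) \<omega> - B (max (\<tau> i) t) \<omega>))" for \<omega>
    unfolding elem_int_def sum_subtractf[symmetric] sum_distrib_left
  proof (rule sum.cong[OF refl])
    fix i assume "i \<in> {..<k}"
    then have "\<tau> i \<le> \<tau> k" "\<tau> (Suc i) \<le> \<tau> k" "\<tau> k \<le> T"
      using simple_pred_mono[OF sp, of i k] simple_pred_mono[OF sp, of "Suc i" k] sp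
      by (auto simp: simple_pred_def)
    then have mT: "min (\<tau> i) T = \<tau> i" "min (\<tau> (Suc i)) T = \<tau> (Suc i)" by auto
    \<comment> \<open>In the difference of two such values \<open>B t\<close> cancels, and the
      \<open>min\<close> parts cancel against the integral up to \<open>t\<close>.\<close>
    have mm: "B x \<omega> = B (max x t) \<omega> - B t \<omega> + B (min x t) \<omega>" for x
      by (cases "x \<le> t") (auto simp: max_def min_def)
    show "indicator A \<omega> * (\<zeta> i \<omega> * (B (min (\<tau> (Suc i)) T) \<omega> - B (min (\<tau> i) T) \<omega>) -
          \<zeta> i \<omega> * (B (min (\<tau> (Suc i)) t) \<omega> - B (min (\<tau> i) t) \<omega>))
        = X i \<omega> * (B (max (\<tau> (Suc i)) t) \<omega> - B (max (\<tau> i) t) \<omega>)"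
      unfolding mT X_def using mm[of "\<tau> i"] mm[of "\<tau> (Suc i)"] by (simp add: algebra_simps)
  qed
  then show ?thesis
    using X by (simp add: Bochner_Integration.integral_sum)
qed

text \<open>Orthogonality compares the times \<open>t\<close> and \<open>T\<close>, so one
  elementary integrand must be close at both. The definition has one approximating sequence for all
  times, hence a common index exists.\<close>

lemma ito_integral_approx:
  assumes ito: "is_ito_integral M Fil B T Z I" and "0 < e" "t \<in> {0..T}" "T \<ge> 0"
  obtains k \<tau> \<zeta> where "simple_pred M Fil T k \<tau> \<zeta>"
    "\<And>u. u \<in> {t, T} \<Longrightarrow> integrable M (\<lambda>\<omega>. elem_int B k \<tau> \<zeta> u \<omega> - I u \<omega>)"
    "\<And>u. u \<in> {t, T} \<Longrightarrow> expectation (\<lambda>\<omega>. \<bar>elem_int B k \<tau> \<zeta> u \<omega> - I u \<omega>\<bar>) \<le> e"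
proof -
  obtain k \<tau> \<zeta> where sp: "\<And>n. simple_pred M Fil T (k n) (\<tau> n) (\<zeta> n)"
    and lim: "\<And>u. u \<in> {0..T} \<Longrightarrow> (\<lambda>n. \<integral>\<^sup>+\<omega>. ennreal ((elem_int B (k n) (\<tau> n) (\<zeta> n) u \<omega> - I u \<omega>)\<^sup>2) \<partial>M) \<longlonglongrightarrow> 0"
    using ito unfolding is_ito_integral_def by blast
  have "\<forall>\<^sub>F n in sequentially. (\<integral>\<^sup>+\<omega>. ennreal ((elem_int B (k n) (\<tau> n) (\<zeta> n) u \<omega> - I u \<omega>)\<^sup>2) \<partial>M) < ennreal (e\<^sup>2)"
    if "u \<in> {0..T}" for u
    using lim[OF that] \<open>0 < e\<close> by (intro order_tendstoD(2)) auto
  from eventually_conj[OF this[of t] this[of T]] assms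
  obtain n where n: "\<And>u. u \<in> {t, T} \<Longrightarrow>
      (\<integral>\<^sup>+\<omega>. ennreal ((elem_int B (k n) (\<tau> n) (\<zeta> n) u \<omega> - I u \<omega>)\<^sup>2) \<partial>M) < ennreal (e\<^sup>2)"
    by (auto dest!: eventually_happens)
  have "(\<lambda>\<omega>. elem_int B (k n) (\<tau> n) (\<zeta> n) u \<omega> - I u \<omega>) \<in> borel_measurable M" if "u \<in> {t, T}" for u
  proof -
    have "u \<in> {0..T}" using that assms by auto
    then have "I u \<in> borel_measurable M" "elem_int B (k n) (\<tau> n) (\<zeta> n) u \<in> borel_measurable M"
      using ito integrable_elem_int[OF sp[of n], of u] by (auto simp: is_ito_integral_def)
    then show ?thesis by simp
  qed
  from expectation_abs_le_of_L2[OF this \<open>0 < e\<close> n] show ?thesis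
    by (intro that[OF sp[of n]])
qed

lemma integrable_ito_integral:
  assumes "is_ito_integral M Fil B T Z I" "t \<in> {0..T}"
  shows "integrable M (I t)"
proof -
  obtain k \<tau> \<zeta> where sp: "simple_pred M Fil T k \<tau> \<zeta>"
    and "\<And>u. u \<in> {t, T} \<Longrightarrow> integrable M (\<lambda>\<omega>. elem_int B k \<tau> \<zeta> u \<omega> - I u \<omega>)"
    by (rule ito_integral_approx[OF assms(1) zero_less_one assms(2)]) (use assms(2) in auto)
  from Bochner_Integration.integrable_diff[OF integrable_elem_int[OF sp, of t] this(2)[of t]] assms(2)
  show ?thesis by simp
qed

text \<open>Elementary integrals satisfy the identity exactly. Replacing the Ito integral by one
  costs at most the sum of the two L1 distances at \<open>t\<close> and \<open>T\<close>, which is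
  why each is taken below half of \<open>e\<close>.\<close>

lemma ito_integral_orthogonal:
  assumes ito: "is_ito_integral M Fil B T Z I" and t: "t \<in> {0..T}" and A: "A \<in> sets (Fil t)"
  shows "expectation (\<lambda>\<omega>. indicator A \<omega> * (I T \<omega> - I t \<omega>)) = 0"
proof -
  let ?a = "expectation (\<lambda>\<omega>. indicator A \<omega> * (I T \<omega> - I t \<omega>))"
  have AM [measurable]: "A \<in> sets M" by (rule sets_Fil_imp_sets[OF A])
  \<comment> \<open>The summand 0 gives the shape that \<open>field_le_epsilon\<close> asks
    for.\<close>
  have "\<bar>?a\<bar> \<le> 0 + e" if "0 < e" for e
  proof -
    from that have "0 < e / 2" by simp
    then obtain k \<tau> \<zeta> where sp: "simple_pred M Fil T k \<tau> \<zeta>"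
      and int: "\<And>u. u \<in> {t, T} \<Longrightarrow> integrable M (\<lambda>\<omega>. elem_int B k \<tau> \<zeta> u \<omega> - I u \<omega>)"
      and le: "\<And>u. u \<in> {t, T} \<Longrightarrow> expectation (\<lambda>\<omega>. \<bar>elem_int B k \<tau> \<zeta> u \<omega> - I u \<omega>\<bar>) \<le> e / 2"
      by (rule ito_integral_approx[OF ito _ t]) (use t in auto)
    define E where "E = elem_int B k \<tau> \<zeta>"
    have intE: "integrable M (E T)" "integrable M (E t)" "integrable M (I T)" "integrable M (I t)"
      using integrable_elem_int[OF sp] integrable_ito_integral[OF ito] t by (auto simp: E_def)
    have indint: "integrable M (\<lambda>\<omega>. indicator A \<omega> * U \<omega>)" if "integrable M U" for U :: "'a \<Rightarrow> real"
      using integrable_mult_indicator[OF AM that] by simp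
    have "?a = ?a - expectation (\<lambda>\<omega>. indicator A \<omega> * (E T \<omega> - E t \<omega>))"
      using elem_int_orthogonal[OF sp t A] by (simp add: E_def)
    also have "\<dots> = expectation (\<lambda>\<omega>. indicator A \<omega> * (I T \<omega> - I t \<omega>) - indicator A \<omega> * (E T \<omega> - E t \<omega>))"
      using intE by (intro Bochner_Integration.integral_diff[symmetric] indint) auto
    finally have "\<bar>?a\<bar> \<le> expectation (\<lambda>\<omega>. \<bar>indicator A \<omega> * (I T \<omega> - I t \<omega>) - indicator A \<omega> * (E T \<omega> - E t \<omega>)\<bar>)"
      using integral_abs_bound[of M "\<lambda>\<omega>. indicator A \<omega> * (I T \<omega> - I t \<omega>) - indicator A \<omega> * (E T \<omega> - E t \<omega>)"] by simp
    also have "\<dots> \<le> expectation (\<lambda>\<omega>. \<bar>E T \<omega> - I T \<omega>\<bar> + \<bar>E t \<omega> - I t \<omega>\<bar>)"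
    proof (rule integral_mono)
      show "integrable M (\<lambda>\<omega>. \<bar>indicator A \<omega> * (I T \<omega> - I t \<omega>) - indicator A \<omega> * (E T \<omega> - E t \<omega>)\<bar>)"
        using intE by (intro integrable_abs Bochner_Integration.integrable_diff indint) auto
    qed (use int in \<open>auto simp: E_def indicator_def\<close>)
    also have "\<dots> \<le> e / 2 + e / 2"
      using int le[of T] le[of t] by (subst Bochner_Integration.integral_add) (auto simp: E_def)
    finally show ?thesis by simp
  qed
  then have "\<bar>?a\<bar> \<le> 0" by (rule field_le_epsilon)
  then show ?thesis by simp
qed

end

subsection \<open>Stieltjes integrals, saddle points and time sections\<close>

text \<open>A nonnegative \<open>g\<close> with integral zero vanishes almost everywhere for the
  measure of \<open>K\<close>, so this measure has no mass where \<open>g\<close> is positive. The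
  witness \<open>q\<close> is the first zero of \<open>g\<close> from \<open>t\<close> on, or
  \<open>T\<close> if there is none.\<close>

lemma stieltjes_int_eq_0_imp_first_contact:
  assumes K: "in_I T K" and g: "continuous_on {0..T} g" "\<And>u. u \<in> {0..T} \<Longrightarrow> 0 \<le> g u"
    and int0: "stieltjes_int T K g = 0" and t: "t \<in> {0..T}"
  obtains q where "q \<in> {t..T}" "K q = K t" "q < T \<Longrightarrow> g q = 0"
proof -
  \<comment> \<open>The same constant extension as in \<open>stieltjes_int\<close>, because
    \<open>interval_measure\<close> takes a function on the whole line.\<close>
  define Kx where "Kx u = K (max 0 (min u T))" for u
  define \<mu> where "\<mu> = interval_measure Kx"
  have T: "0 \<le> T" using t by simp
  have Kx_eq: "Kx u = K u" if "u \<in> {0..T}" for u using that by (simp add: Kx_def)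
  have mono: "Kx x \<le> Kx y" if "x \<le> y" for x y
    unfolding Kx_def by (rule mono_onD[where A="{0..T}"]) (use K that T in \<open>auto simp: in_I_def\<close>)
  have cont: "continuous_on UNIV Kx"
    unfolding Kx_def using K T
    by (intro continuous_on_compose2[where g=K and s=UNIV and t="{0..T}"] continuous_intros) (auto simp: in_I_def)
  have Icc: "emeasure \<mu> {a..b} = ennreal (Kx b - Kx a)" if "a \<le> b" for a b
    unfolding \<mu>_def by (rule emeasure_interval_measure_Icc[OF that mono cont])
  have sets_\<mu> [simp, measurable_cong]: "sets \<mu> = sets borel" and space_\<mu> [simp]: "space \<mu> = UNIV"
    by (simp_all add: \<mu>_def)
  have bm: "(\<lambda>u. indicator {0..T} u *\<^sub>R g u) \<in> borel_measurable \<mu>"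
    using borel_measurable_continuous_on_indicator[OF _ g(1)]
    by (simp add: measurable_cong_sets[OF sets_\<mu> refl])
  obtain C where C: "\<And>u. u \<in> {0..T} \<Longrightarrow> \<bar>g u\<bar> \<le> C"
    using compact_imp_bounded[OF compact_continuous_image[OF g(1) compact_Icc]]
    unfolding bounded_iff real_norm_def by blast
  have "integrable \<mu> (\<lambda>u. indicator {0..T} u *\<^sub>R g u)"
    by (rule integrableI_bounded_set[where A="{0..T}" and B=C]) (use bm C Icc[OF T] in auto)
  moreover have "AE u in \<mu>. 0 \<le> indicator {0..T} u *\<^sub>R g u"
    using g(2) by (auto simp: indicator_def)
  ultimately have AE0: "AE u in \<mu>. indicator {0..T} u *\<^sub>R g u = 0"
    using int0 unfolding stieltjes_int_def set_lebesgue_integral_def Kx_def[symmetric] \<mu>_def[symmetric]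
    by (simp add: integral_nonneg_eq_0_iff_AE)
  \<comment> \<open>\<open>g\<close> may vanish at the right end point \<open>b\<close>; that point
    can be discarded because continuity of \<open>K\<close> excludes atoms.\<close>
  have flat: "K b = K a" if "0 \<le> a" "a \<le> b" "b \<le> T" and pos: "\<And>u. u \<in> {a..<b} \<Longrightarrow> g u \<noteq> 0" for a b
  proof -
    have "{b} \<in> null_sets \<mu>" using Icc[of b b] by (simp add: null_sets_def)
    then have "AE u in \<mu>. u \<notin> {b}" by (rule AE_not_in)
    with AE0 have "AE u in \<mu>. u \<notin> {a..b}"
    proof eventually_elim
      case (elim u)
      then show ?case using pos[of u] that by (auto simp: indicator_def split: if_splits)
    qed
    then have "emeasure \<mu> {a..b} = 0" by (subst (asm) AE_iff_measurable[of "{a..b}"]) auto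
    then have "Kx b \<le> Kx a" using Icc[OF \<open>a \<le> b\<close>] by (simp add: ennreal_eq_0_iff)
    then show ?thesis using mono[OF \<open>a \<le> b\<close>] Kx_eq[of a] Kx_eq[of b] that by simp
  qed
  define S where "S = {u \<in> {t..T}. g u = 0}"
  show ?thesis
  proof (cases "S = {}")
    case True
    then have "K T = K t" using t by (intro flat) (auto simp: S_def)
    then show ?thesis using that[of T] t by auto
  next
    case False
    have "continuous_on {t..T} g" using g(1) t by (auto intro: continuous_on_subset)
    then have "closed S" unfolding S_def
      by (intro continuous_closed_preimage_constant) auto
    then have "compact ({t..T} \<inter> S)" by (intro compact_Int_closed compact_Icc)
    moreover have "{t..T} \<inter> S = S" by (auto simp: S_def)
    ultimately have "compact S" by simp
    then obtain q where q: "q \<in> S" "\<And>u. u \<in> S \<Longrightarrow> q \<le> u"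
      using compact_attains_inf[OF _ False] by blast
    have "K q = K t" using t q by (intro flat) (force simp: S_def)+
    then show ?thesis using that[of q] q(1) by (auto simp: S_def)
  qed
qed

text \<open>The choice \<open>s0\<close> caps both values from above, and \<open>q0\<close> bounds
  both from below. In \<open>ereal\<close> the suprema and infima make sense without any bound on
  \<open>J\<close>.\<close>

lemma saddle_point_minimax:
  fixes J :: "'s \<Rightarrow> 'q \<Rightarrow> real"
  assumes "s0 \<in> S" "q0 \<in> Q" and lower: "\<And>s. s \<in> S \<Longrightarrow> v \<le> J s q0" and upper: "\<And>q. q \<in> Q \<Longrightarrow> J s0 q \<le> v"
  shows "ereal v = (SUP q\<in>Q. INF s\<in>S. ereal (J s q)) \<and> ereal v = (INF s\<in>S. SUP q\<in>Q. ereal (J s q))"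
proof (intro conjI antisym)
  show "ereal v \<le> (SUP q\<in>Q. INF s\<in>S. ereal (J s q))"
    using assms by (intro SUP_upper2[of q0] INF_greatest) auto
  show "(SUP q\<in>Q. INF s\<in>S. ereal (J s q)) \<le> ereal v"
    using assms by (intro SUP_least INF_lower2[of s0]) auto
  show "ereal v \<le> (INF s\<in>S. SUP q\<in>Q. ereal (J s q))"
    using assms by (intro INF_greatest SUP_upper2[of q0]) auto
  show "(INF s\<in>S. SUP q\<in>Q. ereal (J s q)) \<le> ereal v"
    using assms by (intro INF_lower2[of s0] SUP_least) auto
qed

section \<open>Measurability and integrability along paths\<close>

lemma borel_measurable_caratheodory:
  fixes h :: "'s \<Rightarrow> real \<Rightarrow> real \<Rightarrow> real"
  assumes h [measurable]: "\<And>y z. (\<lambda>s. h s y z) \<in> borel_measurable N"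
    and lip: "\<And>s y z y' z'. s \<in> space N \<Longrightarrow> \<bar>h s y z - h s y' z'\<bar> \<le> lam * (\<bar>y - y'\<bar> + \<bar>z - z'\<bar>)"
    and Y [measurable]: "Y \<in> borel_measurable N" and Z [measurable]: "Z \<in> borel_measurable N"
  shows "(\<lambda>s. h s (Y s) (Z s)) \<in> borel_measurable N"
proof -
  \<comment> \<open>Rounding \<open>Y\<close> and \<open>Z\<close> down to the grid of mesh 1 / (n +
    1) leaves countably many arguments, for each of which \<open>h\<close> is measurable; the
    Lipschitz bound then recovers the limit. \<open>r n\<close> gives the index of the grid point
    and \<open>p n\<close> its position.\<close>
  define p :: "nat \<Rightarrow> int \<Rightarrow> real" where "p n i = of_int i / of_nat (Suc n)" for n i
  define r :: "nat \<Rightarrow> real \<Rightarrow> int" where "r n x = \<lfloor>of_nat (Suc n) * x\<rfloor>" for n x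
  have r [measurable]: "r n \<in> measurable borel (count_space UNIV)" for n
    unfolding r_def by measurable
  have approx: "\<bar>p n (r n x) - x\<bar> \<le> 1 / of_nat (Suc n)" for n x
  proof -
    have "\<bar>of_int (r n x) - of_nat (Suc n) * x\<bar> \<le> 1" unfolding r_def by linarith
    then have "\<bar>of_int (r n x) - of_nat (Suc n) * x\<bar> / of_nat (Suc n) \<le> 1 / of_nat (Suc n)"
      by (intro divide_right_mono) auto
    moreover have "p n (r n x) - x = (of_int (r n x) - of_nat (Suc n) * x) / of_nat (Suc n)"
      unfolding p_def by (simp add: field_simps del: of_nat_Suc)
    ultimately show ?thesis by (simp add: abs_divide del: of_nat_Suc)
  qed
  have "(\<lambda>s. h s (p n (r n (Y s))) (p n (r n (Z s)))) \<in> borel_measurable N" for n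
  proof (rule measurable_compose_countable[where f="\<lambda>i s. h s (p n i) (p n (r n (Z s)))" and g="\<lambda>s. r n (Y s)"])
    show "(\<lambda>s. h s (p n i) (p n (r n (Z s)))) \<in> borel_measurable N" for i
      by (rule measurable_compose_countable[where f="\<lambda>j s. h s (p n i) (p n j)" and g="\<lambda>s. r n (Z s)"]) measurable
  qed measurable
  then show ?thesis
  proof (rule borel_measurable_LIMSEQ_real[rotated])
    fix s assume s: "s \<in> space N"
    have bound: "norm (h s (p n (r n (Y s))) (p n (r n (Z s))) - h s (Y s) (Z s)) \<le> \<bar>lam\<bar> * (2 * (1 / of_nat (Suc n)))" for n
    proof -
      have "\<bar>h s (p n (r n (Y s))) (p n (r n (Z s))) - h s (Y s) (Z s)\<bar>
          \<le> lam * (\<bar>p n (r n (Y s)) - Y s\<bar> + \<bar>p n (r n (Z s)) - Z s\<bar>)" by (rule lip[OF s])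
      \<comment> \<open>The sign of \<open>lam\<close> is not given, hence the absolute
        value.\<close>
      also have "\<dots> \<le> \<bar>lam\<bar> * (\<bar>p n (r n (Y s)) - Y s\<bar> + \<bar>p n (r n (Z s)) - Z s\<bar>)"
        by (intro mult_right_mono) auto
      also have "\<dots> \<le> \<bar>lam\<bar> * (2 * (1 / of_nat (Suc n)))"
        using approx[of n "Y s"] approx[of n "Z s"] by (intro mult_left_mono) auto
      finally show ?thesis by simp
    qed
    have "(\<lambda>n. \<bar>lam\<bar> * (2 * (1 / real (Suc n)))) \<longlonglongrightarrow> \<bar>lam\<bar> * (2 * 0)"
      using LIMSEQ_inverse_real_of_nat by (intro tendsto_intros) (simp add: inverse_eq_divide)
    then have "(\<lambda>n. \<bar>lam\<bar> * (2 * (1 / real (Suc n)))) \<longlonglongrightarrow> 0" by simp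
    then have "(\<lambda>n. h s (p n (r n (Y s))) (p n (r n (Z s))) - h s (Y s) (Z s)) \<longlonglongrightarrow> 0"
      by (rule Lim_null_comparison[OF always_eventually[OF allI[OF bound]]])
    then show "(\<lambda>n. h s (p n (r n (Y s))) (p n (r n (Z s)))) \<longlonglongrightarrow> h s (Y s) (Z s)"
      by (simp add: LIM_zero_iff)
  qed
qed

text \<open>A finite double integral makes the inner one finite almost everywhere, and on a bounded
  interval a square integrable path is integrable by \<bar>x\<bar> \<le> 1 + x^2.\<close>

lemma (in sigma_finite_measure) AE_set_integrable_of_L2:
  fixes h :: "real \<Rightarrow> 'a \<Rightarrow> real"
  assumes h: "(\<lambda>(s,\<omega>). h s \<omega>) \<in> borel_measurable (restrict_space borel {0..T} \<Otimes>\<^sub>M M)"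
    and L2: "(\<integral>\<^sup>+\<omega>. (\<integral>\<^sup>+s\<in>{0..T}. ennreal ((h s \<omega>)\<^sup>2) \<partial>lborel) \<partial>M) < \<infinity>"
  shows "AE \<omega> in M. set_integrable lborel {0..T} (\<lambda>s. h s \<omega>)"
proof -
  let ?h = "\<lambda>(\<omega>,s). indicator {0..T} s *\<^sub>R h s \<omega>"
  let ?\<Omega> = "space M \<times> {0..T}"
  \<comment> \<open>\<open>h\<close> is measurable with time first and only over
    \<open>{0..T}\<close>, so the coordinates are swapped and \<open>h\<close> is extended by zero
    before integrating out time.\<close>
  have "(\<lambda>p. (snd p, fst p)) \<in> measurable (restrict_space (M \<Otimes>\<^sub>M lborel) ?\<Omega>) (restrict_space borel {0..T} \<Otimes>\<^sub>M M)"
  proof (rule measurable_Pair)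
    have "snd \<in> measurable (restrict_space (M \<Otimes>\<^sub>M lborel) ?\<Omega>) borel"
      using measurable_snd[of M lborel] by (intro measurable_restrict_space1) simp
    then show "snd \<in> measurable (restrict_space (M \<Otimes>\<^sub>M lborel) ?\<Omega>) (restrict_space borel {0..T})"
      by (rule measurable_restrict_space2[rotated]) (auto simp: space_restrict_space)
    show "fst \<in> measurable (restrict_space (M \<Otimes>\<^sub>M lborel) ?\<Omega>) M"
      by (rule measurable_restrict_space1) simp
  qed
  from measurable_compose[OF this h]
  have "(\<lambda>p. h (snd p) (fst p)) \<in> borel_measurable (restrict_space (M \<Otimes>\<^sub>M lborel) ?\<Omega>)" by simp
  then have "(\<lambda>p. indicator ?\<Omega> p *\<^sub>R h (snd p) (fst p)) \<in> borel_measurable (M \<Otimes>\<^sub>M lborel)"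
    by (subst (asm) borel_measurable_restrict_space_iff) auto
  then have [measurable]: "?h \<in> borel_measurable (M \<Otimes>\<^sub>M lborel)"
    by (rule measurable_cong[THEN iffD1, rotated]) (auto simp: space_pair_measure indicator_def)
  have "(\<lambda>\<omega>. \<integral>\<^sup>+s. ennreal ((?h (\<omega>, s))\<^sup>2) \<partial>lborel) \<in> borel_measurable M"
    by measurable
  moreover have "(\<integral>\<^sup>+s. ennreal ((?h (\<omega>, s))\<^sup>2) \<partial>lborel) = (\<integral>\<^sup>+s\<in>{0..T}. ennreal ((h s \<omega>)\<^sup>2) \<partial>lborel)" for \<omega>
    by (intro nn_integral_cong) (auto simp: indicator_def)
  ultimately have "(\<lambda>\<omega>. \<integral>\<^sup>+s\<in>{0..T}. ennreal ((h s \<omega>)\<^sup>2) \<partial>lborel) \<in> borel_measurable M" by simp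
  from nn_integral_PInf_AE[OF this] L2
  have "AE \<omega> in M. (\<integral>\<^sup>+s\<in>{0..T}. ennreal ((h s \<omega>)\<^sup>2) \<partial>lborel) \<noteq> \<infinity>" by auto
  then show ?thesis
  proof (rule AE_mp, intro AE_I2 impI)
    fix \<omega> assume \<omega>: "\<omega> \<in> space M" and fin: "(\<integral>\<^sup>+s\<in>{0..T}. ennreal ((h s \<omega>)\<^sup>2) \<partial>lborel) \<noteq> \<infinity>"
    have m [measurable]: "(\<lambda>s. indicator {0..T} s *\<^sub>R h s \<omega>) \<in> borel_measurable lborel"
      using measurable_compose[OF measurable_Pair1'[OF \<omega>] \<open>?h \<in> borel_measurable (M \<Otimes>\<^sub>M lborel)\<close>] by simp
    have sq: "integrable lborel (\<lambda>s. (indicator {0..T} s *\<^sub>R h s \<omega>)\<^sup>2)"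
    proof (rule integrableI_bounded)
      have "(\<integral>\<^sup>+s. ennreal (norm ((indicator {0..T} s *\<^sub>R h s \<omega>)\<^sup>2)) \<partial>lborel) = (\<integral>\<^sup>+s\<in>{0..T}. ennreal ((h s \<omega>)\<^sup>2) \<partial>lborel)"
        by (intro nn_integral_cong) (auto simp: indicator_def)
      then show "(\<integral>\<^sup>+s. ennreal (norm ((indicator {0..T} s *\<^sub>R h s \<omega>)\<^sup>2)) \<partial>lborel) < \<infinity>"
        using fin by (simp add: less_top)
    qed measurable
    have "integrable lborel (\<lambda>s. indicator {0..T} s + (indicator {0..T} s *\<^sub>R h s \<omega>)\<^sup>2 :: real)"
      using sq by (intro Bochner_Integration.integrable_add integrable_real_indicator)
        (auto simp: emeasure_lborel_Icc_eq)
    then show "set_integrable lborel {0..T} (\<lambda>s. h s \<omega>)"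
      unfolding set_integrable_def
    proof (rule Bochner_Integration.integrable_bound[OF _ m], intro AE_I2)
      fix s
      have "\<bar>h s \<omega>\<bar> \<le> 1 + (h s \<omega>)\<^sup>2"
        using zero_le_power2[of "\<bar>h s \<omega>\<bar> - 1"] zero_le_power2[of "h s \<omega>"] unfolding power2_diff power2_abs power_one by linarith
      then show "norm (indicator {0..T} s *\<^sub>R h s \<omega>) \<le> norm (indicator {0..T} s + (indicator {0..T} s *\<^sub>R h s \<omega>)\<^sup>2 :: real)"
        by (auto simp: indicator_def)
    qed
  qed
qed

text \<open>The predictable generators are measurable rectangles of the product. Composing with this
  identity map makes a predictable process jointly measurable, as needed for the time sections of
  \<open>Z\<close>.\<close>

lemma measurable_id_predictable_sigma:
  assumes "\<And>s. s \<in> {0..T} \<Longrightarrow> sets (F s) \<subseteq> sets M" "0 \<le> T"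
  shows "(\<lambda>p. p) \<in> measurable (restrict_space borel {0..T} \<Otimes>\<^sub>M M) (predictable_sigma M F T)"
  unfolding predictable_sigma_def
proof (rule measurable_measure_of)
  let ?G = "{{s<..t} \<times> A | s t A. 0 \<le> s \<and> s \<le> t \<and> t \<le> T \<and> A \<in> sets (F s)} \<union> {{0} \<times> A | A. A \<in> sets (F 0)}"
  have G: "E \<in> sets (restrict_space borel {0..T} \<Otimes>\<^sub>M M)" if "E \<in> ?G" for E
  proof -
    consider s t A where "E = {s<..t} \<times> A" "0 \<le> s" "s \<le> t" "t \<le> T" "A \<in> sets (F s)" | A where "E = {0} \<times> A" "A \<in> sets (F 0)"
      using \<open>E \<in> ?G\<close> by blast
    then show ?thesis
    proof cases
      case 1
      then have "{s<..t} \<in> sets (restrict_space borel {0..T})" by (auto simp: sets_restrict_space_iff)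
      with 1 assms(1)[of s] show ?thesis by auto
    next
      case 2
      have "{0} \<in> sets (restrict_space borel {0..T})" using assms(2) by (auto simp: sets_restrict_space_iff)
      with 2 assms(1)[of 0] assms(2) show ?thesis by auto
    qed
  qed
  have "E \<subseteq> {0..T} \<times> space M" if "E \<in> ?G" for E
    using sets.sets_into_space[OF G[OF that]] by (simp add: space_pair_measure space_restrict_space)
  then show "?G \<subseteq> Pow ({0..T} \<times> space M)" by blast
  show "(\<lambda>p. p) -` E \<inter> space (restrict_space borel {0..T} \<Otimes>\<^sub>M M) \<in> sets (restrict_space borel {0..T} \<Otimes>\<^sub>M M)" if "E \<in> ?G" for E
    using G[OF that] by auto
qed (auto simp: space_pair_measure space_restrict_space)

subsection \<open>Mean constraints\<close>

text \<open>What \<open>L\<close> and \<open>R\<close> share, so that roots and continuity are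
  treated once for both. \<open>expanding\<close> merges strict monotonicity with the lower bound
  into a slope estimate, and \<open>measurable_constraint\<close> keeps of joint measurability only
  compositions at a fixed time.\<close>

locale mean_constraint = prob_space M for M :: "'a measure" +
  fixes G :: "'a \<Rightarrow> real \<Rightarrow> real \<Rightarrow> real" and T c C :: real
  assumes measurable_constraint:
      "\<And>t W. t \<in> {0..T} \<Longrightarrow> W \<in> borel_measurable M \<Longrightarrow> (\<lambda>\<omega>. G \<omega> t (W \<omega>)) \<in> borel_measurable M"
    and continuous_constraint: "\<And>\<omega> x. \<omega> \<in> space M \<Longrightarrow> continuous_on {0..T} (\<lambda>t. G \<omega> t x)"
    and integrable_sup: "integrable M (\<lambda>\<omega>. SUP t\<in>{0..T}. \<bar>G \<omega> t 0\<bar>)"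
    and c_pos: "0 < c" and C_nonneg: "0 \<le> C"
    and expanding: "\<And>\<omega> t x y. \<omega> \<in> space M \<Longrightarrow> t \<in> {0..T} \<Longrightarrow> x \<le> y \<Longrightarrow> c * (y - x) \<le> G \<omega> t y - G \<omega> t x"
    and lipschitz: "\<And>\<omega> t x y. \<omega> \<in> space M \<Longrightarrow> t \<in> {0..T} \<Longrightarrow> \<bar>G \<omega> t x - G \<omega> t y\<bar> \<le> C * \<bar>x - y\<bar>"
begin

lemma constraint_bound:
  assumes "\<omega> \<in> space M" "t \<in> {0..T}"
  shows "\<bar>G \<omega> t x\<bar> \<le> (SUP t\<in>{0..T}. \<bar>G \<omega> t 0\<bar>) + C * \<bar>x\<bar>"
proof -
  \<comment> \<open>A real supremum dominates its members only when they are bounded above;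
    continuity on a compact interval ensures this.\<close>
  have "compact ((\<lambda>t. \<bar>G \<omega> t 0\<bar>) ` {0..T})"
    by (intro compact_continuous_image continuous_on_rabs continuous_constraint assms compact_Icc)
  then have "bdd_above ((\<lambda>t. \<bar>G \<omega> t 0\<bar>) ` {0..T})"
    by (intro bounded_imp_bdd_above compact_imp_bounded)
  then have "\<bar>G \<omega> t 0\<bar> \<le> (SUP t\<in>{0..T}. \<bar>G \<omega> t 0\<bar>)" using assms by (intro cSUP_upper) auto
  then show ?thesis using lipschitz[OF assms, of x 0] by simp
qed

lemma integrable_constraint:
  assumes "t \<in> {0..T}" "integrable M W"
  shows "integrable M (\<lambda>\<omega>. G \<omega> t (W \<omega>))"
proof (rule Bochner_Integration.integrable_bound)
  show "integrable M (\<lambda>\<omega>. (SUP t\<in>{0..T}. \<bar>G \<omega> t 0\<bar>) + C * \<bar>W \<omega>\<bar>)"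
    using integrable_sup assms by simp
  show "AE \<omega> in M. norm (G \<omega> t (W \<omega>)) \<le> norm ((SUP t\<in>{0..T}. \<bar>G \<omega> t 0\<bar>) + C * \<bar>W \<omega>\<bar>)"
    using constraint_bound[OF _ assms(1)] by (intro AE_I2) (smt (verit) real_norm_def)
qed (use measurable_constraint assms in auto)

lemma expectation_constraint_diff:
  assumes t: "t \<in> {0..T}" and W: "integrable M W"
  shows "x \<le> y \<Longrightarrow> c * (y - x) \<le> expectation (\<lambda>\<omega>. G \<omega> t (W \<omega> + y)) - expectation (\<lambda>\<omega>. G \<omega> t (W \<omega> + x))"
    and "\<bar>expectation (\<lambda>\<omega>. G \<omega> t (W \<omega> + y)) - expectation (\<lambda>\<omega>. G \<omega> t (W \<omega> + x))\<bar> \<le> C * \<bar>y - x\<bar>"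
proof -
  have int: "integrable M (\<lambda>\<omega>. G \<omega> t (W \<omega> + r))" for r
    using integrable_constraint[OF t, of "\<lambda>\<omega>. W \<omega> + r"] W by simp
  have eq: "expectation (\<lambda>\<omega>. G \<omega> t (W \<omega> + y)) - expectation (\<lambda>\<omega>. G \<omega> t (W \<omega> + x))
      = expectation (\<lambda>\<omega>. G \<omega> t (W \<omega> + y) - G \<omega> t (W \<omega> + x))"
    using int by simp
  show "c * (y - x) \<le> expectation (\<lambda>\<omega>. G \<omega> t (W \<omega> + y)) - expectation (\<lambda>\<omega>. G \<omega> t (W \<omega> + x))" if "x \<le> y"
  proof -
    have "expectation (\<lambda>_. c * (y - x)) \<le> expectation (\<lambda>\<omega>. G \<omega> t (W \<omega> + y) - G \<omega> t (W \<omega> + x))"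
    proof (rule integral_mono)
      fix \<omega> assume "\<omega> \<in> space M"
      from expanding[OF this t, of "W \<omega> + x" "W \<omega> + y"] that
      show "c * (y - x) \<le> G \<omega> t (W \<omega> + y) - G \<omega> t (W \<omega> + x)" by simp
    qed (use int in auto)
    then show ?thesis unfolding eq by (simp add: prob_space)
  qed
  have "\<bar>expectation (\<lambda>\<omega>. G \<omega> t (W \<omega> + y) - G \<omega> t (W \<omega> + x))\<bar>
      \<le> expectation (\<lambda>\<omega>. \<bar>G \<omega> t (W \<omega> + y) - G \<omega> t (W \<omega> + x)\<bar>)"
    by (rule integral_abs_bound)
  also have "\<dots> \<le> expectation (\<lambda>_. C * \<bar>y - x\<bar>)"
  proof (rule integral_mono)
    fix \<omega> assume "\<omega> \<in> space M"
    from lipschitz[OF this t, of "W \<omega> + y" "W \<omega> + x"]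
    show "\<bar>G \<omega> t (W \<omega> + y) - G \<omega> t (W \<omega> + x)\<bar> \<le> C * \<bar>y - x\<bar>" by simp
  qed (use int in auto)
  finally show "\<bar>expectation (\<lambda>\<omega>. G \<omega> t (W \<omega> + y)) - expectation (\<lambda>\<omega>. G \<omega> t (W \<omega> + x))\<bar> \<le> C * \<bar>y - x\<bar>"
    unfolding eq by (simp add: prob_space)
qed

text \<open>\<open>\<phi>\<close> is continuous with slope at least \<open>c\<close>, so it has
  exactly one zero, the \<open>THE\<close> denotes it, and the sign of \<open>\<phi>\<close> at a
  point tells on which side of the zero this point lies.\<close>

lemma expectation_constraint_root:
  assumes t: "t \<in> {0..T}" and W: "integrable M W"
  defines "\<phi> \<equiv> \<lambda>r. expectation (\<lambda>\<omega>. G \<omega> t (W \<omega> + r))"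
  shows "\<phi> r = 0 \<Longrightarrow> (THE r. \<phi> r = 0) = r"
    and "0 \<le> \<phi> r \<Longrightarrow> (THE r. \<phi> r = 0) \<le> r" and "\<phi> r \<le> 0 \<Longrightarrow> r \<le> (THE r. \<phi> r = 0)"
proof -
  have diff: "x \<le> y \<Longrightarrow> c * (y - x) \<le> \<phi> y - \<phi> x" "\<bar>\<phi> y - \<phi> x\<bar> \<le> C * \<bar>y - x\<bar>" for x y
    unfolding \<phi>_def by (fact expectation_constraint_diff[OF t W])+
  have strict: "\<phi> x < \<phi> y" if "x < y" for x y
  proof -
    have "0 < c * (y - x)" using that c_pos by simp
    then show ?thesis using diff(1)[of x y] that by simp
  qed
  have cont: "isCont \<phi> x" for x
  proof -
    have "((\<lambda>z. C * \<bar>z - x\<bar>) \<longlongrightarrow> C * \<bar>x - x\<bar>) (at x)" by (intro tendsto_intros)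
    then have "((\<lambda>z. C * \<bar>z - x\<bar>) \<longlongrightarrow> 0) (at x)" by simp
    then have "((\<lambda>z. \<phi> z - \<phi> x) \<longlongrightarrow> 0) (at x)"
      by (rule Lim_null_comparison[rotated]) (use diff(2) in auto)
    then show ?thesis by (simp add: isCont_def LIM_zero_iff)
  qed
  \<comment> \<open>With slope at least \<open>c\<close>, moving from 0 to
    \<open>- \<phi> 0 / c\<close> makes up for the value at 0, so a zero lies between these two
    points.\<close>
  have "\<exists>r. \<phi> r = 0"
  proof (cases "\<phi> 0 \<le> 0")
    case True
    have nn: "0 \<le> - \<phi> 0 / c" using True c_pos by (simp add: divide_nonpos_pos)
    then have "0 \<le> \<phi> (- \<phi> 0 / c)" using diff(1)[OF nn] c_pos by simp
    with True nn cont show ?thesis using IVT[of \<phi> 0 0 "- \<phi> 0 / c"] by auto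
  next
    case False
    have nn: "- \<phi> 0 / c \<le> 0" using False c_pos by (simp add: field_simps)
    then have "\<phi> (- \<phi> 0 / c) \<le> 0" using diff(1)[OF nn] c_pos by simp
    with False nn cont show ?thesis using IVT[of \<phi> "- \<phi> 0 / c" 0 0] by auto
  qed
  then obtain r0 where r0: "\<phi> r0 = 0" by blast
  have the: "(THE r. \<phi> r = 0) = r'" if "\<phi> r' = 0" for r'
  proof (rule the_equality)
    show "\<phi> r' = 0" by (rule that)
    fix x assume "\<phi> x = 0"
    then show "x = r'" using strict[of x r'] strict[of r' x] that by (cases x r' rule: linorder_cases) auto
  qed
  show "\<phi> r = 0 \<Longrightarrow> (THE r. \<phi> r = 0) = r" by (rule the)
  show "0 \<le> \<phi> r \<Longrightarrow> (THE r. \<phi> r = 0) \<le> r"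
    using strict[of r r0] the[OF r0] r0 by (cases "r0 \<le> r") auto
  show "\<phi> r \<le> 0 \<Longrightarrow> r \<le> (THE r. \<phi> r = 0)"
    using strict[of r0 r] the[OF r0] r0 by (cases "r \<le> r0") auto
qed

text \<open>Time enters both through \<open>G\<close> and through \<open>Y\<close>. The Lipschitz
  bound absorbs the change of \<open>Y\<close>, continuity of \<open>G\<close> in time at the fixed
  argument \<open>Y t\<close> does the rest, and the linear growth bound with \<open>D\<close>
  dominates.\<close>

lemma continuous_expectation_constraint:
  assumes Y: "\<And>t. t \<in> {0..T} \<Longrightarrow> Y t \<in> borel_measurable M"
    and cont: "\<And>\<omega>. \<omega> \<in> space M \<Longrightarrow> continuous_on {0..T} (\<lambda>t. Y t \<omega>)"
    and D: "integrable M D" "\<And>t \<omega>. t \<in> {0..T} \<Longrightarrow> \<omega> \<in> space M \<Longrightarrow> \<bar>Y t \<omega>\<bar> \<le> D \<omega>"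
  shows "continuous_on {0..T} (\<lambda>t. expectation (\<lambda>\<omega>. G \<omega> t (Y t \<omega>)))"
  unfolding continuous_on_sequentially comp_def
proof (intro allI ballI impI, elim conjE)
  fix u :: "nat \<Rightarrow> real" and t
  assume t: "t \<in> {0..T}" and u: "\<forall>n. u n \<in> {0..T}" "u \<longlonglongrightarrow> t"
  show "(\<lambda>n. expectation (\<lambda>\<omega>. G \<omega> (u n) (Y (u n) \<omega>))) \<longlonglongrightarrow> expectation (\<lambda>\<omega>. G \<omega> t (Y t \<omega>))"
  proof (rule integral_dominated_convergence[where w="\<lambda>\<omega>. (SUP t\<in>{0..T}. \<bar>G \<omega> t 0\<bar>) + C * D \<omega>"])
    show "AE \<omega> in M. (\<lambda>n. G \<omega> (u n) (Y (u n) \<omega>)) \<longlonglongrightarrow> G \<omega> t (Y t \<omega>)"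
    proof (intro AE_I2)
      fix \<omega> assume \<omega>: "\<omega> \<in> space M"
      have Yn: "(\<lambda>n. Y (u n) \<omega>) \<longlonglongrightarrow> Y t \<omega>"
        using cont[OF \<omega>] u t unfolding continuous_on_sequentially comp_def by blast
      have Gn: "(\<lambda>n. G \<omega> (u n) (Y t \<omega>)) \<longlonglongrightarrow> G \<omega> t (Y t \<omega>)"
        using continuous_constraint[OF \<omega>, of "Y t \<omega>"] u t unfolding continuous_on_sequentially comp_def by blast
      have "(\<lambda>n. C * \<bar>Y (u n) \<omega> - Y t \<omega>\<bar>) \<longlonglongrightarrow> C * \<bar>Y t \<omega> - Y t \<omega>\<bar>"
        by (intro tendsto_intros Yn)
      then have "(\<lambda>n. C * \<bar>Y (u n) \<omega> - Y t \<omega>\<bar>) \<longlonglongrightarrow> 0" by simp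
      then have "(\<lambda>n. G \<omega> (u n) (Y (u n) \<omega>) - G \<omega> (u n) (Y t \<omega>)) \<longlonglongrightarrow> 0"
        by (rule Lim_null_comparison[rotated]) (use lipschitz[OF \<omega>] u in auto)
      from tendsto_add[OF this Gn] show "(\<lambda>n. G \<omega> (u n) (Y (u n) \<omega>)) \<longlonglongrightarrow> G \<omega> t (Y t \<omega>)" by simp
    qed
    show "AE \<omega> in M. norm (G \<omega> (u n) (Y (u n) \<omega>)) \<le> (SUP t\<in>{0..T}. \<bar>G \<omega> t 0\<bar>) + C * D \<omega>" for n
    proof (intro AE_I2)
      fix \<omega> assume \<omega>: "\<omega> \<in> space M"
      have "C * \<bar>Y (u n) \<omega>\<bar> \<le> C * D \<omega>" using D(2)[OF _ \<omega>] u C_nonneg by (intro mult_left_mono) auto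
      then show "norm (G \<omega> (u n) (Y (u n) \<omega>)) \<le> (SUP t\<in>{0..T}. \<bar>G \<omega> t 0\<bar>) + C * D \<omega>"
        using constraint_bound[OF \<omega>, of "u n" "Y (u n) \<omega>"] u by simp
    qed
  qed (use measurable_constraint Y t u integrable_sup D(1) in auto)
qed

end

subsection \<open>The doubly mean reflected equation\<close>

text \<open>The preimages differ only inside a null set, and completeness makes that part
  measurable. This is how path integrals become random variables below.\<close>

lemma borel_measurable_AE_eq_complete:
  assumes "complete_space_measure M" "H \<in> borel_measurable M" "AE \<omega> in M. G \<omega> = H \<omega>"
  shows "G \<in> borel_measurable M"
proof (rule measurableI)
  fix A :: "'b set" assume A: "A \<in> sets borel"
  obtain N where N: "N \<in> null_sets M" "{\<omega> \<in> space M. G \<omega> \<noteq> H \<omega>} \<subseteq> N"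
    using assms(3) by (auto simp: eventually_ae_filter)
  have "G -` A \<inter> space M = (H -` A \<inter> space M - N) \<union> (G -` A \<inter> space M \<inter> N)"
    using N(2) by auto
  moreover have "G -` A \<inter> space M \<inter> N \<in> sets M"
    using assms(1) N(1) unfolding complete_space_measure_def by blast
  moreover have "H -` A \<inter> space M - N \<in> sets M"
    using measurable_sets[OF assms(2) A] N(1) by auto
  ultimately show "G -` A \<inter> space M \<in> sets M" by (metis sets.Un)
qed simp

lemma set_lebesgue_integral_Icc_add:
  fixes h :: "real \<Rightarrow> real"
  assumes "set_integrable lborel {a..b} h" "a \<le> m" "m \<le> b"
  shows "(LINT s:{a..b}|lborel. h s) = (LINT s:{a..m}|lborel. h s) + (LINT s:{m..b}|lborel. h s)"
proof -
  have "AE s in lborel. \<not> (s \<in> {a..m} \<and> s \<in> {m..b})"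
    using AE_lborel_singleton[of m] by eventually_elim auto
  moreover have "set_integrable lborel {a..m} h" "set_integrable lborel {m..b} h"
    using assms by (auto intro: set_integrable_subset)
  moreover have "{a..m} \<union> {m..b} = {a..b}" using assms by auto
  ultimately show ?thesis using set_integral_Un_AE[where M=lborel and A="{a..m}" and B="{m..b}" and f=h] by simp
qed

locale mean_reflected_bsde = brownian M B for M :: "'a measure" and B +
  fixes T :: real and \<xi> :: "'a \<Rightarrow> real" and f :: "'a \<Rightarrow> real \<Rightarrow> real \<Rightarrow> real \<Rightarrow> real"
    and L R :: "'a \<Rightarrow> real \<Rightarrow> real \<Rightarrow> real"
    and Y Z :: "real \<Rightarrow> 'a \<Rightarrow> real" and K :: "real \<Rightarrow> real"
  assumes complete: "complete_space_measure M"
    and T_pos: "0 < T"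
    and \<xi>_measurable: "\<xi> \<in> borel_measurable (Fil T)"
    and \<xi>_square_integrable: "integrable M (\<lambda>\<omega>. (\<xi> \<omega>)\<^sup>2)"
    and LR: "assumption_LR M Fil T L R"
    and f: "assumption_f M Fil T f"
    and solution: "solves_P M Fil B T \<xi> f L R Y Z K"
begin

lemma integrable_\<xi>: "integrable M \<xi>"
  using square_integrable_imp_integrable[OF measurable_Fil_imp_measurable[OF \<xi>_measurable] \<xi>_square_integrable] .

lemma Y_adapted: "t \<in> {0..T} \<Longrightarrow> Y t \<in> borel_measurable (Fil t)"
  using solution by (auto simp: solves_P_def in_S2_def)

lemma Y_measurable: "t \<in> {0..T} \<Longrightarrow> Y t \<in> borel_measurable M"
  by (rule measurable_Fil_imp_measurable[OF Y_adapted])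

lemma Y_continuous: "\<omega> \<in> space M \<Longrightarrow> continuous_on {0..T} (\<lambda>t. Y t \<omega>)"
  using solution by (auto simp: solves_P_def in_S2_def)

lemma Y_le_sup:
  assumes "\<omega> \<in> space M" "t \<in> {0..T}"
  shows "\<bar>Y t \<omega>\<bar> \<le> (SUP t\<in>{0..T}. \<bar>Y t \<omega>\<bar>)"
proof -
  have "compact ((\<lambda>t. \<bar>Y t \<omega>\<bar>) ` {0..T})"
    by (intro compact_continuous_image continuous_on_rabs Y_continuous assms compact_Icc)
  then have "bdd_above ((\<lambda>t. \<bar>Y t \<omega>\<bar>) ` {0..T})"
    by (intro bounded_imp_bdd_above compact_imp_bounded)
  then show ?thesis using assms by (intro cSUP_upper) auto
qed

lemma integrable_sup_Y: "integrable M (\<lambda>\<omega>. SUP t\<in>{0..T}. \<bar>Y t \<omega>\<bar>)"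
proof -
  have sq: "integrable M (\<lambda>\<omega>. (SUP t\<in>{0..T}. \<bar>Y t \<omega>\<bar>)\<^sup>2)"
    using solution by (auto simp: solves_P_def in_S2_def)
  \<comment> \<open>The hypothesis makes only the square of the supremum measurable; its root
    recovers the supremum, which is nonnegative.\<close>
  have "(\<lambda>\<omega>. sqrt ((SUP t\<in>{0..T}. \<bar>Y t \<omega>\<bar>)\<^sup>2)) \<in> borel_measurable M"
    using borel_measurable_integrable[OF sq] by measurable
  moreover have "sqrt ((SUP t\<in>{0..T}. \<bar>Y t \<omega>\<bar>)\<^sup>2) = (SUP t\<in>{0..T}. \<bar>Y t \<omega>\<bar>)" if "\<omega> \<in> space M" for \<omega>
    using Y_le_sup[OF that, of 0] T_pos by simp
  ultimately have "(\<lambda>\<omega>. SUP t\<in>{0..T}. \<bar>Y t \<omega>\<bar>) \<in> borel_measurable M"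
    by (simp cong: measurable_cong)
  then show ?thesis by (rule square_integrable_imp_integrable[OF _ sq])
qed

lemma integrable_Y: "t \<in> {0..T} \<Longrightarrow> integrable M (Y t)"
  using Y_le_sup Y_measurable
  by (intro Bochner_Integration.integrable_bound[OF integrable_sup_Y] AE_I2) (auto intro: order_trans[OF _ abs_ge_self])

abbreviation drift :: "real \<Rightarrow> real \<Rightarrow> 'a \<Rightarrow> real" where
  "drift a b \<omega> \<equiv> set_lebesgue_integral lborel {a..b} (\<lambda>s. f \<omega> s (Y s \<omega>) (Z s \<omega>))"

text \<open>The Lipschitz condition dominates the driver by its value at the origin plus a multiple
  of \<bar>Y\<bar> + \<bar>Z\<bar>, and each of these has integrable paths almost surely. It is
  needed to add path integrals over adjacent intervals.\<close>

lemma AE_driver_integrable: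
  "AE \<omega> in M. set_integrable lborel {0..T} (\<lambda>s. f \<omega> s (Y s \<omega>) (Z s \<omega>))"
proof -
  let ?N = "restrict_space borel {0..T} :: real measure"
  have T: "0 \<le> T" using T_pos by simp
  obtain lam where lip: "\<And>\<omega> t y z y' z'. \<omega> \<in> space M \<Longrightarrow> t \<in> {0..T} \<Longrightarrow>
      \<bar>f \<omega> t y z - f \<omega> t y' z'\<bar> \<le> lam * (\<bar>y - y'\<bar> + \<bar>z - z'\<bar>)"
    using f unfolding assumption_f_def by blast
  have id: "(\<lambda>p. p) \<in> measurable (?N \<Otimes>\<^sub>M M) (?N \<Otimes>\<^sub>M Fil T)"
  proof (rule measurable_pair)
    have "fst \<in> measurable (?N \<Otimes>\<^sub>M M) ?N" "snd \<in> measurable (?N \<Otimes>\<^sub>M M) M" by measurable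
    moreover have "(\<lambda>\<omega>. \<omega>) \<in> measurable M (Fil T)"
      using sets_Fil_imp_sets by (intro measurableI) auto
    ultimately show "fst \<circ> (\<lambda>p. p) \<in> measurable (?N \<Otimes>\<^sub>M M) ?N" "snd \<circ> (\<lambda>p. p) \<in> measurable (?N \<Otimes>\<^sub>M M) (Fil T)"
      by (auto simp: comp_def)
  qed
  have fm: "(\<lambda>(s,\<omega>). f \<omega> s y z) \<in> borel_measurable (?N \<Otimes>\<^sub>M M)" for y z
  proof -
    have "(\<lambda>(s,\<omega>). f \<omega> s y z) \<in> borel_measurable (?N \<Otimes>\<^sub>M Fil T)"
      using f T unfolding assumption_f_def by auto
    from measurable_compose[OF id this] show ?thesis .
  qed
  have Zm: "(\<lambda>(s,\<omega>). Z s \<omega>) \<in> borel_measurable (?N \<Otimes>\<^sub>M M)"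
  proof -
    have "(\<lambda>(s,\<omega>). Z s \<omega>) \<in> borel_measurable (predictable_sigma M Fil T)"
      using solution by (auto simp: solves_P_def in_H2_def)
    from measurable_compose[OF measurable_id_predictable_sigma this] show ?thesis
      using sets_Fil_imp_sets T by auto
  qed
  have "AE \<omega> in M. set_integrable lborel {0..T} (\<lambda>s. f \<omega> s 0 0)"
    using f by (intro AE_set_integrable_of_L2[OF fm]) (auto simp: assumption_f_def)
  moreover have "AE \<omega> in M. set_integrable lborel {0..T} (\<lambda>s. Z s \<omega>)"
    using solution by (intro AE_set_integrable_of_L2[OF Zm]) (auto simp: solves_P_def in_H2_def)
  ultimately show ?thesis
    using AE_space
  proof eventually_elim
    case (elim \<omega>)
    have sec: "(\<lambda>s. (s, \<omega>)) \<in> measurable ?N (?N \<Otimes>\<^sub>M M)"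
      using elim(3) by measurable
    have Ym: "(\<lambda>s. Y s \<omega>) \<in> borel_measurable ?N"
      by (rule borel_measurable_continuous_on_restrict[OF Y_continuous[OF elim(3)]])
    have Zs: "(\<lambda>s. Z s \<omega>) \<in> borel_measurable ?N"
      using measurable_compose[OF sec Zm] by simp
    have fs: "(\<lambda>s. f \<omega> s y z) \<in> borel_measurable ?N" for y z
      using measurable_compose[OF sec fm] by simp
    have "(\<lambda>s. f \<omega> s (Y s \<omega>) (Z s \<omega>)) \<in> borel_measurable ?N"
      by (rule borel_measurable_caratheodory[where lam=lam, OF fs _ Ym Zs]) (use lip[OF elim(3)] in \<open>auto simp: space_restrict_space\<close>)
    then have m: "(\<lambda>s. indicator {0..T} s *\<^sub>R f \<omega> s (Y s \<omega>) (Z s \<omega>)) \<in> borel_measurable lborel"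
      by (simp add: borel_measurable_restrict_space_iff)
    have Yi: "set_integrable lborel {0..T} (\<lambda>s. Y s \<omega>)"
      by (rule borel_integrable_atLeastAtMost'[OF Y_continuous[OF elim(3)]])
    have "set_integrable lborel {0..T} (\<lambda>s. \<bar>f \<omega> s 0 0\<bar> + \<bar>lam\<bar> * (\<bar>Y s \<omega>\<bar> + \<bar>Z s \<omega>\<bar>))"
      using elim(1,2) Yi by (intro set_integral_add set_integrable_mult_right set_integrable_abs)
    then show ?case
      unfolding set_integrable_def
    proof (rule Bochner_Integration.integrable_bound[OF _ m], intro AE_I2)
      fix s
      show "norm (indicator {0..T} s *\<^sub>R f \<omega> s (Y s \<omega>) (Z s \<omega>))
          \<le> norm (indicator {0..T} s *\<^sub>R (\<bar>f \<omega> s 0 0\<bar> + \<bar>lam\<bar> * (\<bar>Y s \<omega>\<bar> + \<bar>Z s \<omega>\<bar>)))"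
      proof (cases "s \<in> {0..T}")
        case True
        have "lam * (\<bar>Y s \<omega>\<bar> + \<bar>Z s \<omega>\<bar>) \<le> \<bar>lam\<bar> * (\<bar>Y s \<omega>\<bar> + \<bar>Z s \<omega>\<bar>)" by (intro mult_right_mono) auto
        moreover have "\<bar>f \<omega> s (Y s \<omega>) (Z s \<omega>) - f \<omega> s 0 0\<bar> \<le> lam * (\<bar>Y s \<omega>\<bar> + \<bar>Z s \<omega>\<bar>)"
          using lip[OF elim(3) True, of "Y s \<omega>" "Z s \<omega>" 0 0] by simp
        ultimately have "\<bar>f \<omega> s (Y s \<omega>) (Z s \<omega>)\<bar> \<le> \<bar>f \<omega> s 0 0\<bar> + \<bar>lam\<bar> * (\<bar>Y s \<omega>\<bar> + \<bar>Z s \<omega>\<bar>)"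
          by linarith
        with True show ?thesis by simp
      qed simp
    qed
  qed
qed

section \<open>The equation in conditional mean and in mean\<close>

lemma obtain_ito_integral:
  obtains I where "is_ito_integral M Fil B T Z I"
    "\<And>t. t \<in> {0..T} \<Longrightarrow> AE \<omega> in M. Y t \<omega> = \<xi> \<omega> + drift t T \<omega> - (I T \<omega> - I t \<omega>) + K T - K t"
  using solution unfolding solves_P_def by blast

text \<open>Solving the equation for the drift expresses it almost surely through integrable
  variables, so no moment estimate on the driver is required. Integrated over \<open>A\<close>, the
  Ito increment drops out by orthogonality.\<close>

lemma drift_to_T:
  assumes t: "t \<in> {0..T}"
  shows integrable_drift_to_T: "integrable M (drift t T)"
    and set_integral_drift_to_T: "\<And>A. A \<in> sets (Fil t) \<Longrightarrow>
      (LINT \<omega>:A|M. \<xi> \<omega> + drift t T \<omega>) = (LINT \<omega>:A|M. Y t \<omega> - (K T - K t))"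
proof -
  obtain I where ito: "is_ito_integral M Fil B T Z I"
    and eq: "AE \<omega> in M. Y t \<omega> = \<xi> \<omega> + drift t T \<omega> - (I T \<omega> - I t \<omega>) + K T - K t"
    by (rule obtain_ito_integral) (use t in blast)
  have T: "T \<in> {0..T}" using T_pos by simp
  note int = integrable_ito_integral[OF ito T] integrable_ito_integral[OF ito t] integrable_Y[OF t] integrable_\<xi>
  let ?H = "\<lambda>\<omega>. Y t \<omega> - \<xi> \<omega> + (I T \<omega> - I t \<omega>) - (K T - K t)"
  have H: "integrable M ?H" using int by simp
  have AE_H: "AE \<omega> in M. drift t T \<omega> = ?H \<omega>" using eq by eventually_elim simp
  have m: "drift t T \<in> borel_measurable M"
    by (rule borel_measurable_AE_eq_complete[OF complete borel_measurable_integrable[OF H] AE_H])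
  show "integrable M (drift t T)"
    using integrable_cong_AE[OF m borel_measurable_integrable[OF H] AE_H] H by simp
  fix A assume A: "A \<in> sets (Fil t)"
  have AM [measurable]: "A \<in> sets M" by (rule sets_Fil_imp_sets[OF A])
  have ind: "integrable M (\<lambda>\<omega>. indicator A \<omega> * U \<omega>)" if "integrable M U" for U :: "'a \<Rightarrow> real"
    using integrable_mult_indicator[OF AM that] by simp
  have "(LINT \<omega>:A|M. \<xi> \<omega> + drift t T \<omega>)
      = expectation (\<lambda>\<omega>. indicator A \<omega> * (Y t \<omega> - (K T - K t)) + indicator A \<omega> * (I T \<omega> - I t \<omega>))"
    unfolding set_lebesgue_integral_def[of M]
  proof (rule integral_cong_AE)
    have [measurable]: "\<xi> \<in> borel_measurable M" "Y t \<in> borel_measurable M" "I T \<in> borel_measurable M"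
      "I t \<in> borel_measurable M" "drift t T \<in> borel_measurable M"
      using int m by auto
    show "(\<lambda>\<omega>. indicator A \<omega> *\<^sub>R (\<xi> \<omega> + drift t T \<omega>)) \<in> borel_measurable M"
      "(\<lambda>\<omega>. indicator A \<omega> * (Y t \<omega> - (K T - K t)) + indicator A \<omega> * (I T \<omega> - I t \<omega>)) \<in> borel_measurable M"
      by measurable
    show "AE \<omega> in M. indicator A \<omega> *\<^sub>R (\<xi> \<omega> + drift t T \<omega>)
        = indicator A \<omega> * (Y t \<omega> - (K T - K t)) + indicator A \<omega> * (I T \<omega> - I t \<omega>)"
      using eq by eventually_elim (simp add: indicator_def)
  qed
  also have "\<dots> = expectation (\<lambda>\<omega>. indicator A \<omega> * (Y t \<omega> - (K T - K t))) + expectation (\<lambda>\<omega>. indicator A \<omega> * (I T \<omega> - I t \<omega>))"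
    using int by (intro Bochner_Integration.integral_add ind) auto
  also have "\<dots> = (LINT \<omega>:A|M. Y t \<omega> - (K T - K t))"
    using ito_integral_orthogonal[OF ito t A] by (simp add: set_lebesgue_integral_def)
  finally show "(LINT \<omega>:A|M. \<xi> \<omega> + drift t T \<omega>) = (LINT \<omega>:A|M. Y t \<omega> - (K T - K t))" .
qed

text \<open>Because \<open>K\<close> is deterministic, \<open>Y t - (K T - K t)\<close> is
  measurable at time \<open>t\<close>; the identity of set integrals then characterises it as the
  conditional expectation.\<close>

lemma cond_exp_eq:
  assumes t: "t \<in> {0..T}"
  shows "AE \<omega> in M. real_cond_exp M (Fil t) (\<lambda>\<omega>. \<xi> \<omega> + drift t T \<omega>) \<omega> = Y t \<omega> - (K T - K t)"
proof -
  interpret sub: finite_measure_subalgebra M "Fil t"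
    by unfold_locales (rule subalgebra_Fil)
  show ?thesis
  proof (rule sub.real_cond_exp_charact)
    show "integrable M (\<lambda>\<omega>. \<xi> \<omega> + drift t T \<omega>)"
      using integrable_\<xi> integrable_drift_to_T[OF t] by simp
    show "integrable M (\<lambda>\<omega>. Y t \<omega> - (K T - K t))" using integrable_Y[OF t] by simp
    show "(\<lambda>\<omega>. Y t \<omega> - (K T - K t)) \<in> borel_measurable (Fil t)" using Y_adapted[OF t] by simp
  qed (rule set_integral_drift_to_T[OF t])
qed

lemma expectation_Y_eq:
  assumes t: "t \<in> {0..T}"
  shows "expectation (Y t) = expectation \<xi> + expectation (drift t T) + K T - K t"
proof -
  have "space M \<in> sets (Fil t)" using sets.top[of "Fil t"] by simp
  from set_integral_drift_to_T[OF t this]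
  have "expectation (\<lambda>\<omega>. \<xi> \<omega> + drift t T \<omega>) = expectation (\<lambda>\<omega>. Y t \<omega> - (K T - K t))"
    by (simp add: set_integral_space integrable_\<xi> integrable_drift_to_T[OF t] integrable_Y[OF t])
  then show ?thesis
    using integrable_\<xi> integrable_drift_to_T[OF t] integrable_Y[OF t] by (simp add: prob_space)
qed

lemma expectation_Y_T: "expectation (Y T) = expectation \<xi>"
proof -
  have "drift T T \<omega> = 0" for \<omega>
    unfolding set_lebesgue_integral_def
    using AE_lborel_singleton[of T] by (intro integral_eq_zero_AE) (auto elim!: eventually_mono)
  then show ?thesis using expectation_Y_eq[of T] T_pos by simp
qed

text \<open>The drift from \<open>t\<close> to \<open>m\<close> is the drift from \<open>t\<close>
  to \<open>T\<close> less that from \<open>m\<close> to \<open>T\<close>, almost surely by path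
  integrability of the driver. In the means \<open>\<xi>\<close> and \<open>K T\<close>
  cancel.\<close>

lemma drift_between:
  assumes "0 \<le> t" "t \<le> m" "m \<le> T"
  shows integrable_drift: "integrable M (drift t m)"
    and expectation_drift: "expectation (drift t m) = expectation (Y t) - expectation (Y m) + K t - K m"
proof -
  have tm: "t \<in> {0..T}" "m \<in> {0..T}" using assms by auto
  let ?H = "\<lambda>\<omega>. drift t T \<omega> - drift m T \<omega>"
  have H: "integrable M ?H" using integrable_drift_to_T tm by simp
  have AE_H: "AE \<omega> in M. drift t m \<omega> = ?H \<omega>"
    using AE_driver_integrable
  proof eventually_elim
    case (elim \<omega>)
    have "set_integrable lborel {t..T} (\<lambda>s. f \<omega> s (Y s \<omega>) (Z s \<omega>))"
      using assms by (intro set_integrable_subset[OF elim]) auto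
    from set_lebesgue_integral_Icc_add[OF this assms(2,3)] show ?case by simp
  qed
  have m: "drift t m \<in> borel_measurable M"
    by (rule borel_measurable_AE_eq_complete[OF complete borel_measurable_integrable[OF H] AE_H])
  show "integrable M (drift t m)"
    using integrable_cong_AE[OF m borel_measurable_integrable[OF H] AE_H] H by simp
  have "expectation (drift t m) = expectation ?H"
    by (rule integral_cong_AE[OF m borel_measurable_integrable[OF H] AE_H])
  then show "expectation (drift t m) = expectation (Y t) - expectation (Y m) + K t - K m"
    using expectation_Y_eq[OF tm(1)] expectation_Y_eq[OF tm(2)] integrable_drift_to_T[OF tm(1)] integrable_drift_to_T[OF tm(2)]
    by simp
qed

text \<open>Inserting the mean drift splits the payoff into the mean of \<open>Y t\<close>, the
  decrease of \<open>K\<close> up to the stopping time, and the excess of the reward over the mean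
  of \<open>Y\<close> at that time. If both players wait until \<open>T\<close>, the reward is
  \<open>\<xi>\<close>, whose mean is that of \<open>Y T\<close>, and there is no excess.\<close>

lemma payoff:
  fixes r l :: real
  assumes "0 \<le> t" "s \<in> {t..T}" "q \<in> {t..T}"
  defines "J \<equiv> expectation (\<lambda>\<omega>. drift t (min s q) \<omega> + \<xi> \<omega> * (if min s q = T then 1 else 0))
      + r * (if q < T \<and> q \<le> s then 1 else 0) + l * (if s < q then 1 else 0)"
  shows "s < q \<Longrightarrow> J = expectation (Y t) + K t - K s + (l - expectation (Y s))"
    and "q \<le> s \<Longrightarrow> q < T \<Longrightarrow> J = expectation (Y t) + K t - K q + (r - expectation (Y q))"
    and "q = T \<Longrightarrow> s = T \<Longrightarrow> J = expectation (Y t) + K t - K T"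
proof -
  have "expectation (\<lambda>\<omega>. drift t (min s q) \<omega> + \<xi> \<omega> * (if min s q = T then 1 else 0))
      = expectation (Y t) - expectation (Y (min s q)) + K t - K (min s q) + expectation \<xi> * (if min s q = T then 1 else 0)"
    using integrable_drift[of t "min s q"] expectation_drift[of t "min s q"] assms(1-3) integrable_\<xi>
    by (subst Bochner_Integration.integral_add) auto
  then show "s < q \<Longrightarrow> J = expectation (Y t) + K t - K s + (l - expectation (Y s))"
    "q \<le> s \<Longrightarrow> q < T \<Longrightarrow> J = expectation (Y t) + K t - K q + (r - expectation (Y q))"
    "q = T \<Longrightarrow> s = T \<Longrightarrow> J = expectation (Y t) + K t - K T"
    using assms(2,3) expectation_Y_T by (auto simp: J_def min_def)
qed

lemma measurable_Fil_composition:
  assumes G: "(\<lambda>(\<omega>,t,x). G \<omega> t x) \<in> borel_measurable (Fil T \<Otimes>\<^sub>M (restrict_space borel {0..T} \<Otimes>\<^sub>M borel))"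
    and t: "t \<in> {0..T}" and W: "W \<in> borel_measurable M"
  shows "(\<lambda>\<omega>. G \<omega> t (W \<omega>) :: real) \<in> borel_measurable M"
proof -
  have "(\<lambda>\<omega>. \<omega>) \<in> measurable M (Fil T)" using sets_Fil_imp_sets by (intro measurableI) auto
  moreover have "(\<lambda>\<omega>. t) \<in> measurable M (restrict_space borel {0..T})"
    using t by (intro measurable_const) (simp add: space_restrict_space)
  ultimately have "(\<lambda>\<omega>. (\<omega>, t, W \<omega>)) \<in> measurable M (Fil T \<Otimes>\<^sub>M (restrict_space borel {0..T} \<Otimes>\<^sub>M borel))"
    using W by (intro measurable_Pair)
  from measurable_compose[OF this G] show ?thesis by simp
qed

lemma obtain_mean_constraints:
  obtains c C where "mean_constraint M L T c C" "mean_constraint M R T c C"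
proof -
  obtain c C where cC: "0 < c" "c < C" and bi: "\<And>\<omega> t. \<omega> \<in> space M \<Longrightarrow> t \<in> {0..T} \<Longrightarrow>
        strict_mono (L \<omega> t) \<and> strict_mono (R \<omega> t) \<and>
        (\<forall>x y. c * \<bar>x - y\<bar> \<le> \<bar>L \<omega> t x - L \<omega> t y\<bar> \<and> \<bar>L \<omega> t x - L \<omega> t y\<bar> \<le> C * \<bar>x - y\<bar> \<and>
               c * \<bar>x - y\<bar> \<le> \<bar>R \<omega> t x - R \<omega> t y\<bar> \<and> \<bar>R \<omega> t x - R \<omega> t y\<bar> \<le> C * \<bar>x - y\<bar>)"
    using LR unfolding assumption_LR_def by blast
  have constraint: "mean_constraint M G T c C"
    if G: "(\<lambda>(\<omega>,t,x). G \<omega> t x) \<in> borel_measurable (Fil T \<Otimes>\<^sub>M (restrict_space borel {0..T} \<Otimes>\<^sub>M borel))"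
      "\<And>\<omega> x. \<omega> \<in> space M \<Longrightarrow> continuous_on {0..T} (\<lambda>t. G \<omega> t x)"
      "integrable M (\<lambda>\<omega>. SUP t\<in>{0..T}. \<bar>G \<omega> t 0\<bar>)"
      "\<And>\<omega> t. \<omega> \<in> space M \<Longrightarrow> t \<in> {0..T} \<Longrightarrow> strict_mono (G \<omega> t)"
      "\<And>\<omega> t x y. \<omega> \<in> space M \<Longrightarrow> t \<in> {0..T} \<Longrightarrow> c * \<bar>x - y\<bar> \<le> \<bar>G \<omega> t x - G \<omega> t y\<bar>"
      "\<And>\<omega> t x y. \<omega> \<in> space M \<Longrightarrow> t \<in> {0..T} \<Longrightarrow> \<bar>G \<omega> t x - G \<omega> t y\<bar> \<le> C * \<bar>x - y\<bar>"
    for G :: "'a \<Rightarrow> real \<Rightarrow> real \<Rightarrow> real"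
  proof
    fix \<omega> t and x y :: real assume *: "\<omega> \<in> space M" "t \<in> {0..T}" "x \<le> y"
    then show "c * (y - x) \<le> G \<omega> t y - G \<omega> t x"
      using G(5)[OF *(1,2), of y x] strict_mono_leD[OF G(4)[OF *(1,2)] *(3)] by simp
  qed (fact G measurable_Fil_composition[OF G(1)] | use cC in simp)+
  have "mean_constraint M L T c C"
    using LR bi unfolding assumption_LR_def by (intro constraint) blast+
  moreover have "mean_constraint M R T c C"
    using LR bi unfolding assumption_LR_def by (intro constraint) blast+
  ultimately show ?thesis by (rule that)
qed

text \<open>Centring removes the deterministic shift \<open>K T - K t\<close>, so the two integrands
  agree almost surely for every shift by \<open>r\<close>.\<close>

lemma centred_root_eq:
  assumes "mean_constraint M G T c C" and t: "t \<in> {0..T}"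
  defines "Yb \<equiv> real_cond_exp M (Fil t) (\<lambda>\<omega>. \<xi> \<omega> + drift t T \<omega>)"
  shows "(THE r. expectation (\<lambda>\<omega>. G \<omega> t (Yb \<omega> - expectation Yb + r)) = 0)
    = (THE r. expectation (\<lambda>\<omega>. G \<omega> t (Y t \<omega> - expectation (Y t) + r)) = 0)"
proof -
  interpret mean_constraint M G T c C by fact
  have AE: "AE \<omega> in M. Yb \<omega> = Y t \<omega> - (K T - K t)" unfolding Yb_def by (rule cond_exp_eq[OF t])
  have Yb: "Yb \<in> borel_measurable M" unfolding Yb_def by (rule borel_measurable_cond_exp2)
  note Ym = Y_measurable[OF t]
  have "expectation Yb = expectation (\<lambda>\<omega>. Y t \<omega> - (K T - K t))"
    using Yb Ym AE by (intro integral_cong_AE) auto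
  then have mean: "expectation Yb = expectation (Y t) - (K T - K t)"
    using integrable_Y[OF t] by (simp add: prob_space)
  have "expectation (\<lambda>\<omega>. G \<omega> t (Yb \<omega> - expectation Yb + r)) = expectation (\<lambda>\<omega>. G \<omega> t (Y t \<omega> - expectation (Y t) + r))" for r
  proof (rule integral_cong_AE)
    show "(\<lambda>\<omega>. G \<omega> t (Yb \<omega> - expectation Yb + r)) \<in> borel_measurable M"
      using Yb by (intro measurable_constraint[OF t]) simp
    show "(\<lambda>\<omega>. G \<omega> t (Y t \<omega> - expectation (Y t) + r)) \<in> borel_measurable M"
      using Ym by (intro measurable_constraint[OF t]) simp
    show "AE \<omega> in M. G \<omega> t (Yb \<omega> - expectation Yb + r) = G \<omega> t (Y t \<omega> - expectation (Y t) + r)"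
      using AE by eventually_elim (simp add: mean)
  qed
  then show ?thesis by simp
qed

text \<open>Adding its mean to the centred \<open>Y t\<close> gives \<open>Y t\<close> back. The
  function whose root is sought thus takes the value of the constraint at the mean of
  \<open>Y t\<close>, and the sign of that value locates the root.\<close>

lemma centred_root:
  assumes "mean_constraint M G T c C" and t: "t \<in> {0..T}"
  defines "r \<equiv> THE r. expectation (\<lambda>\<omega>. G \<omega> t (Y t \<omega> - expectation (Y t) + r)) = 0"
  shows "expectation (\<lambda>\<omega>. G \<omega> t (Y t \<omega>)) = 0 \<Longrightarrow> r = expectation (Y t)"
    and "0 \<le> expectation (\<lambda>\<omega>. G \<omega> t (Y t \<omega>)) \<Longrightarrow> r \<le> expectation (Y t)"
    and "expectation (\<lambda>\<omega>. G \<omega> t (Y t \<omega>)) \<le> 0 \<Longrightarrow> expectation (Y t) \<le> r"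
proof -
  interpret mean_constraint M G T c C by fact
  have "integrable M (\<lambda>\<omega>. Y t \<omega> - expectation (Y t))" using integrable_Y[OF t] by simp
  from expectation_constraint_root[OF t this, where r="expectation (Y t)", folded r_def]
  show "expectation (\<lambda>\<omega>. G \<omega> t (Y t \<omega>)) = 0 \<Longrightarrow> r = expectation (Y t)"
    "0 \<le> expectation (\<lambda>\<omega>. G \<omega> t (Y t \<omega>)) \<Longrightarrow> r \<le> expectation (Y t)"
    "expectation (\<lambda>\<omega>. G \<omega> t (Y t \<omega>)) \<le> 0 \<Longrightarrow> expectation (Y t) \<le> r"
    by simp_all
qed

lemma continuous_mean_constraint:
  assumes "mean_constraint M G T c C"
  shows "continuous_on {0..T} (\<lambda>t. expectation (\<lambda>\<omega>. G \<omega> t (Y t \<omega>)))"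
proof -
  interpret mean_constraint M G T c C by fact
  show ?thesis
    by (rule continuous_expectation_constraint[OF Y_measurable Y_continuous integrable_sup_Y]) (auto intro: Y_le_sup)
qed

lemma dynkin_game_value:
  assumes t: "t \<in> {0..T}"
    and r: "\<And>u. r u = (THE r. expectation (\<lambda>\<omega>. R \<omega> u (real_cond_exp M (Fil u) (\<lambda>\<omega>. \<xi> \<omega> + drift u T \<omega>) \<omega>
        - expectation (real_cond_exp M (Fil u) (\<lambda>\<omega>. \<xi> \<omega> + drift u T \<omega>)) + r)) = 0)"
    and l: "\<And>u. l u = (THE l. expectation (\<lambda>\<omega>. L \<omega> u (real_cond_exp M (Fil u) (\<lambda>\<omega>. \<xi> \<omega> + drift u T \<omega>) \<omega>
        - expectation (real_cond_exp M (Fil u) (\<lambda>\<omega>. \<xi> \<omega> + drift u T \<omega>)) + l)) = 0)"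
    and J: "\<And>s q. J s q = expectation (\<lambda>\<omega>. drift t (min s q) \<omega> + \<xi> \<omega> * (if min s q = T then 1 else 0))
      + r q * (if q < T \<and> q \<le> s then 1 else 0) + l s * (if s < q then 1 else 0)"
  shows "ereal (expectation (Y t)) = (SUP q\<in>{t..T}. INF s\<in>{t..T}. ereal (J s q))
       \<and> ereal (expectation (Y t)) = (INF s\<in>{t..T}. SUP q\<in>{t..T}. ereal (J s q))"
proof -
  define gR where "gR u = expectation (\<lambda>\<omega>. R \<omega> u (Y u \<omega>))" for u
  define gL where "gL u = expectation (\<lambda>\<omega>. L \<omega> u (Y u \<omega>))" for u
  obtain c C where cL: "mean_constraint M L T c C" and cR: "mean_constraint M R T c C"
    by (rule obtain_mean_constraints)
  have bounds: "gL u \<le> 0" "0 \<le> gR u" if "u \<in> {0..T}" for u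
    using solution that by (auto simp: solves_P_def gL_def gR_def)
  obtain KR KL where KR: "in_I T KR" and KL: "in_I T KL" and K: "\<And>u. u \<in> {0..T} \<Longrightarrow> K u = KR u - KL u"
    and SR: "stieltjes_int T KR gR = 0" and SL: "stieltjes_int T KL gL = 0"
    using solution unfolding solves_P_def gL_def gR_def by blast
  have r_le: "r u \<le> expectation (Y u)" and r_eq: "gR u = 0 \<Longrightarrow> r u = expectation (Y u)"
    and l_ge: "expectation (Y u) \<le> l u" and l_eq: "gL u = 0 \<Longrightarrow> l u = expectation (Y u)" if u: "u \<in> {0..T}" for u
    using centred_root[OF cR u] centred_root[OF cL u] bounds[OF u]
    unfolding r[of u] l[of u] centred_root_eq[OF cR u] centred_root_eq[OF cL u] gR_def gL_def by auto
  have mono: "KR u \<le> KR v" "KL u \<le> KL v" if "u \<in> {0..T}" "v \<in> {0..T}" "u \<le> v" for u v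
    using KR KL mono_onD[of "{0..T}" KR u v] mono_onD[of "{0..T}" KL u v] that by (auto simp: in_I_def)
  obtain q0 where q0: "q0 \<in> {t..T}" "KR q0 = KR t" "q0 < T \<Longrightarrow> gR q0 = 0"
    by (rule stieltjes_int_eq_0_imp_first_contact[OF KR _ _ SR t])
       (use continuous_mean_constraint[OF cR] bounds in \<open>auto simp: gR_def\<close>)
  \<comment> \<open>The constraint for \<open>L\<close> is nonpositive, whereas the first contact
    time is found for nonnegative integrands.\<close>
  have "stieltjes_int T KL (\<lambda>u. - gL u) = 0"
    using SL by (simp add: stieltjes_int_def set_lebesgue_integral_def)
  from stieltjes_int_eq_0_imp_first_contact[OF KL _ _ this t]
  obtain s0 where s0: "s0 \<in> {t..T}" "KL s0 = KL t" "s0 < T \<Longrightarrow> gL s0 = 0"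
    using continuous_on_minus[OF continuous_mean_constraint[OF cL]] bounds by (auto simp: gL_def)
  have t0: "0 \<le> t" using t by simp
  have payoff: "s < q \<Longrightarrow> J s q = expectation (Y t) + K t - K s + (l s - expectation (Y s))"
    "q \<le> s \<Longrightarrow> q < T \<Longrightarrow> J s q = expectation (Y t) + K t - K q + (r q - expectation (Y q))"
    "q = T \<Longrightarrow> s = T \<Longrightarrow> J s q = expectation (Y t) + K t - K T"
    if "s \<in> {t..T}" "q \<in> {t..T}" for s q
    using payoff[OF t0 that, where r="r q" and l="l s"] unfolding J by blast+
  show ?thesis
  proof (rule saddle_point_minimax[where ?s0.0=s0 and ?q0.0=q0])
    fix s assume s: "s \<in> {t..T}"
    \<comment> \<open>Both players waiting until \<open>T\<close> is a case of its own:
      \<open>J\<close> then pays \<open>\<xi>\<close> and neither \<open>r\<close> nor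
      \<open>l\<close>.\<close>
    consider "s < q0" | "q0 \<le> s" "q0 < T" | "q0 = T" "s = T" using s q0(1) by fastforce
    then show "expectation (Y t) \<le> J s q0"
    proof cases
      case 1
      \<comment> \<open>\<open>KR\<close> has not grown by time \<open>s\<close>, so K t - K s \<ge>
        KL s - KL t \<ge> 0; the excess of \<open>l s\<close> over the mean of \<open>Y s\<close> is
        nonnegative as well.\<close>
      have "KR s \<le> KR t" using mono(1)[of s q0] q0 s t 1 by auto
      then show ?thesis
        using payoff(1)[OF s q0(1) 1] l_ge[of s] K[of s] K[of t] mono(2)[of t s] s t by auto
    next
      case 2
      \<comment> \<open>At a contact time before \<open>T\<close> the reward \<open>r q0\<close>
        equals the mean of \<open>Y q0\<close>, so only the growth of \<open>KL\<close> remains, and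
        it raises the payoff.\<close>
      then show ?thesis
        using payoff(2)[OF s q0(1) 2] r_eq[of q0] K[of q0] K[of t] mono(2)[of t q0] q0 t by auto
    next
      case 3
      then show ?thesis
        using payoff(3)[OF s q0(1) 3] K[of T] K[of t] mono(2)[of t T] q0 t by auto
    qed
  next
    fix q assume q: "q \<in> {t..T}"
    consider "s0 < q" | "q \<le> s0" "q < T" | "q = T" "s0 = T" using q s0(1) by fastforce
    then show "J s0 q \<le> expectation (Y t)"
    proof cases
      case 1
      \<comment> \<open>At \<open>s0\<close> the reward \<open>l s0\<close> is the mean of
        \<open>Y s0\<close> and \<open>KL\<close> has not grown since \<open>t\<close>, so only the
        growth of \<open>KR\<close> remains, and it lowers the payoff.\<close>
      then show ?thesis
        using payoff(1)[OF s0(1) q 1] l_eq[of s0] K[of s0] K[of t] mono(1)[of t s0] s0 q t by auto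
    next
      case 2
      \<comment> \<open>\<open>KL\<close> is flat up to \<open>s0\<close>; the growth of
        \<open>KR\<close> and the inequality between \<open>r q\<close> and the mean of
        \<open>Y q\<close> both push the payoff down.\<close>
      have "KL q \<le> KL t" using mono(2)[of q s0] s0 q t 2 by auto
      then show ?thesis
        using payoff(2)[OF s0(1) q 2] r_le[of q] K[of q] K[of t] mono(1)[of t q] q t by auto
    next
      case 3
      then show ?thesis
        using payoff(3)[OF s0(1) q 3] K[of T] K[of t] mono(1)[of t T] s0 t by auto
    qed
  qed (use s0 q0 in auto)
qed

end

theorem mainTheorem7:
  fixes M :: "'a measure" and B :: "real \<Rightarrow> 'a \<Rightarrow> real" and T :: real
    and \<xi> :: "'a \<Rightarrow> real" and f :: "'a \<Rightarrow> real \<Rightarrow> real \<Rightarrow> real \<Rightarrow> real"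
    and L R :: "'a \<Rightarrow> real \<Rightarrow> real \<Rightarrow> real"
    and Y Z :: "real \<Rightarrow> 'a \<Rightarrow> real" and K :: "real \<Rightarrow> real"
    and F :: "real \<Rightarrow> 'a measure"
    and Ybar :: "real \<Rightarrow> 'a \<Rightarrow> real" and rbar lbar :: "real \<Rightarrow> real"
    and J :: "real \<Rightarrow> real \<Rightarrow> real \<Rightarrow> real"
  assumes "prob_space M" and "complete_space_measure M"
    and "std_brownian_motion M B"
    and F_def: "F = aug_nat_filtration M B"
    and "0 < T"
    and "\<xi> \<in> borel_measurable (F T)" and "integrable M (\<lambda>\<omega>. (\<xi> \<omega>)\<^sup>2)"
    and "assumption_LR M F T L R"
    and "(\<integral>\<omega>. L \<omega> T (\<xi> \<omega>) \<partial>M) \<le> 0" and "0 \<le> (\<integral>\<omega>. R \<omega> T (\<xi> \<omega>) \<partial>M)"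
    and "assumption_f M F T f"
    and "solves_P M F B T \<xi> f L R Y Z K"
    and Ybar_def: "\<And>t. Ybar t = real_cond_exp M (F t)
          (\<lambda>\<omega>. \<xi> \<omega> + set_lebesgue_integral lborel {t..T} (\<lambda>s. f \<omega> s (Y s \<omega>) (Z s \<omega>)))"
    and rbar_def: "\<And>t. rbar t = (THE r. (\<integral>\<omega>. R \<omega> t (Ybar t \<omega> - (\<integral>\<omega>'. Ybar t \<omega>' \<partial>M) + r) \<partial>M) = 0)"
    and lbar_def: "\<And>t. lbar t = (THE l. (\<integral>\<omega>. L \<omega> t (Ybar t \<omega> - (\<integral>\<omega>'. Ybar t \<omega>' \<partial>M) + l) \<partial>M) = 0)"
    and J_def: "\<And>t s q. J t s q =
          (\<integral>\<omega>. set_lebesgue_integral lborel {t..min s q} (\<lambda>u. f \<omega> u (Y u \<omega>) (Z u \<omega>))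
                 + \<xi> \<omega> * (if min s q = T then 1 else 0) \<partial>M)
          + rbar q * (if q < T \<and> q \<le> s then 1 else 0)
          + lbar s * (if s < q then 1 else 0)"
    and "t \<in> {0..T}"
  shows "ereal (\<integral>\<omega>. Y t \<omega> \<partial>M) = (SUP q\<in>{t..T}. INF s\<in>{t..T}. ereal (J t s q))
       \<and> ereal (\<integral>\<omega>. Y t \<omega> \<partial>M) = (INF s\<in>{t..T}. SUP q\<in>{t..T}. ereal (J t s q))"
proof -
  interpret prob_space M by fact
  interpret mean_reflected_bsde M B T \<xi> f L R Y Z K
    by unfold_locales (use assms in auto)
  have Y_bar: "Ybar u = real_cond_exp M (Fil u) (\<lambda>\<omega>. \<xi> \<omega> + drift u T \<omega>)" for u
    unfolding Ybar_def F_def ..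
  show ?thesis
    by (rule dynkin_game_value[OF \<open>t \<in> {0..T}\<close> rbar_def[unfolded Y_bar] lbar_def[unfolded Y_bar] J_def])
qed

end
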